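(* Let $m\ge 0$ be an integer and let $\psi,\varphi,\phi$ be entire functions with $\phi\not\equiv 0$, and suppose that $\psi$ vanishes nowhere. Let $\mathbb{S}_{\max}$ be the maximal multi-valued weighted composition operator on $\mathcal{F}^2$ induced by the equation $\psi\cdot f\circ\varphi=\phi\cdot g^{(m)}$. Then the following assertions are equivalent. (1) $\mathbb{S}_{\max}$ is hermitian. (2) $G(\mathbb{S}_{\max}^* )\subseteq G(\mathbb{S}_{\max})$. (3) There is a triple $(\psi_1,\varphi,\phi_1)$ equivalent to $(\psi,\varphi,\phi)$ and constants $A\in\mathbb{R}$, $C\in\mathbb{R}\setminus\{0\}$, $B\in\mathbb{C}$ such that $$\varphi(u)=Au+B,\qquad Ce^{u\overline{B}}\phi_1(u)=\psi_1(u)(Au+B)^m,\qquad u\in\mathbb{C}.$$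
   Context: Fock space $\mathcal{F}^2$ is the Hilbert space of entire functions $f$ with $\int_{\mathbb{C}}|f(z)|^2e^{-|z|^2}dV(z)<\infty$, with inner product $\langle f,g\rangle=\frac1\pi\int_{\mathbb{C}}f(z)\overline{g(z)}e^{-|z|^2}dV(z)$, where $dV$ is area measure. A multi-valued linear operator $\mathbb{A}$ on a Hilbert space $\mathcal{H}$ assigns to each $x$ in a subspace $\mathrm{dom}(\mathbb{A})\subset\mathcal{H}$ a nonempty subset $\mathbb{A}(x)\subset\mathcal{H}$ such that its graph $G(\mathbb{A})=\{(x,y):x\in\mathrm{dom}(\mathbb{A}),\,y\in\mathbb{A}(x)\}$ is a linear subspace of $\mathcal{H}\times\mathcal{H}$; $\mathbb{A}$ is determined by $G(\mathbb{A})$. The operator $\mathbb{S}_{\max}$ is given by $G(\mathbb{S}_{\max})=\{(f,g)\in\mathcal{F}^2\times\mathcal{F}^2:\psi(z)f(\varphi(z))=\phi(z)g^{(m)}(z)\ \forall z\in\mathbb{C}\}$. The adjoint $\mathbb{A}^*$ is given by $G(\mathbb{A}^* )=\{(u,v):\langle g,u\rangle=\langle f,v\rangle\ \forall (f,g)\in G(\mathbb{A})\}$, and $\mathbb{A}$ is hermitian if $G(\mathbb{A}^* )=G(\mathbb{A})$. Triples of entire functions $(\psi,\varphi,\phi)$ and $(\psi_1,\varphi,\phi_1)$ (with $\psi,\psi_1\not\equiv0$) are equivalent if $\phi/\psi=\phi_1/\psi_1$ as meromorphic functions.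
   Formalization: For m ≥ 1 the map φ-variant (varphi) is additionally assumed non-constant; as printed the equivalence fails there, e.g. m=1, ψ=1, varphi=1, phi(u)=e^{-u} satisfies (3) but S_max is not hermitian. Constant varphi is kept for m=0. *)

theory Defs
  imports "HOL-Complex_Analysis.Complex_Analysis"
begin

definition fock :: "(complex \<Rightarrow> complex) set" where
  "fock = {f. f holomorphic_on UNIV \<and>
              integrable lborel (\<lambda>z. (cmod (f z))\<^sup>2 * exp (- (cmod z)\<^sup>2))}"

definition fock_inner :: "(complex \<Rightarrow> complex) \<Rightarrow> (complex \<Rightarrow> complex) \<Rightarrow> complex" where
  "fock_inner f g = complex_of_real (1 / pi) *
     (LINT z|lborel. f z * cnj (g z) * complex_of_real (exp (- (cmod z)\<^sup>2)))"

(* A multi-valued linear operator on the Fock space is represented by its graph.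
   In Smax_graph, \<phi> is the composition symbol (varphi on paper) and \<theta> is the factor in front of
   the derivative (phi on paper).

   Pitfall: for m > 0 the characterization of hermitian Smax_graph is false for constant \<phi>.
   With m = 1, \<psi> = 1, \<phi> = 1, \<theta> u = exp (- u) one has \<theta> u * exp u = \<phi> u, so the
   formulas hold with A = 0, B = C = 1, but the graph contains (0, 1) and (1 - z, 0) while
   <1, 1 - z> = 1 and <0, 0> = 0, so it is not contained in its adjoint.
   With m = 1, \<psi> = 1, \<phi> = 0, \<theta> u = u the graph is {(f, g). f 0 = 0 and g constant}, which is
   hermitian, but the formulas would force \<theta> = 0. *)

type_synonym mv_graph = "((complex \<Rightarrow> complex) \<times> (complex \<Rightarrow> complex)) set"

definition Smax_graph ::
  "nat \<Rightarrow> (complex \<Rightarrow> complex) \<Rightarrow> (complex \<Rightarrow> complex) \<Rightarrow> (complex \<Rightarrow> complex) \<Rightarrow> mv_graph" where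
  "Smax_graph m \<psi> \<phi> \<theta> =
     {(f, g). f \<in> fock \<and> g \<in> fock \<and> (\<forall>z. \<psi> z * f (\<phi> z) = \<theta> z * (deriv ^^ m) g z)}"

definition adjoint_graph :: "mv_graph \<Rightarrow> mv_graph" where
  "adjoint_graph G =
     {(u, v). u \<in> fock \<and> v \<in> fock \<and> (\<forall>(f, g) \<in> G. fock_inner g u = fock_inner f v)}"

definition hermitian_graph :: "mv_graph \<Rightarrow> bool" where
  "hermitian_graph G \<longleftrightarrow> adjoint_graph G = G"

(* The quotients are compared as meromorphic functions, that is, away from a set without
   accumulation points (HOL's convention x / 0 = 0 makes equality at the zeros of the
   denominators meaningless). *)

definition equivalent_triples ::
  "(complex \<Rightarrow> complex) \<times> (complex \<Rightarrow> complex) \<times> (complex \<Rightarrow> complex) \<Rightarrow>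
   (complex \<Rightarrow> complex) \<times> (complex \<Rightarrow> complex) \<times> (complex \<Rightarrow> complex) \<Rightarrow> bool" where
  "equivalent_triples = (\<lambda>(\<psi>, \<phi>, \<theta>) (\<psi>1, \<phi>1, \<theta>1).
     (\<forall>h \<in> {\<psi>, \<phi>, \<theta>, \<psi>1, \<phi>1, \<theta>1}. h holomorphic_on UNIV) \<and>
     (\<exists>z. \<psi> z \<noteq> 0) \<and> (\<exists>z. \<psi>1 z \<noteq> 0) \<and> \<phi>1 = \<phi> \<and>
     (\<forall>\<^sub>\<approx>z\<in>UNIV. \<theta> z / \<psi> z = \<theta>1 z / \<psi>1 z))"

end

theory Submission
  imports Defs "HOL-Probability.Distributions"
begin

text \<open>
  Since \<open>\<psi>\<close> has no zeros, only the entire function \<open>F = \<theta> / \<psi>\<close> matters: the relation consists of the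
  pairs \<open>(f, g)\<close> for which \<open>f \<circ> \<phi>\<close> is \<open>F\<close> times the \<open>m\<close>-th derivative of \<open>g\<close>. On Fock space,
  evaluating the \<open>m\<close>-th derivative at \<open>z\<close> is the inner product with the kernel \<open>w\<^sup>m e\<^bsup>w cnj z\<^esup>\<close>
  (\<open>fock_reproducing_deriv\<close>), so the equation at \<open>z\<close>, for all pairs of the relation, says that the kernel pair \<open>(cnj (F z) w\<^sup>m e\<^bsup>w cnj z\<^esup>, e\<^bsup>w cnj (\<phi> z)\<^esup>)\<close> lies in the adjoint. Hence the
  relation is itself the adjoint of the set of kernel pairs, and everything is about them.

  If the adjoint is contained in the relation, the kernel pairs satisfy the defining equation, which
  is an identity in two complex variables (\<open>adjoint_subset_imp_kernel_identity\<close>). Dividing by powers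
  of \<open>\<phi>\<close> and differentiating the exponents turns it into \<open>\<phi>' \<cdot> cnj z = cnj (\<phi> z - \<phi> 0)\<close>, which leaves
  only affine \<open>\<phi>\<close> with real slope and the stated \<open>F\<close> (\<open>kernel_identity_solution\<close>).

  Conversely, for \<open>\<phi> u = A u + B\<close> and \<open>F u = c e\<^bsup>-u cnj B\<^esup> (A u + B)\<^sup>m\<close> with \<open>c\<close> real, the kernel pairs
  satisfy the equation, and testing an element of the adjoint against them shows that it satisfies
  the equation too (\<open>adjoint_subset\<close>). The other inclusion is the analytic part: the relation, with
  its maximal domain, has to be symmetric. Formally it is \<open>f = z\<^sup>m T D\<^sup>m g\<close>, where \<open>D\<^sup>m\<close> and
  multiplication by \<open>z\<^sup>m\<close> are adjoint to each other and \<open>T\<close> is the weighted composition with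
  an affine map, whose integral kernel is hermitian because \<open>A\<close> and \<open>c\<close> are real. All integrals that
  have to be exchanged converge absolutely as soon as the kernel grows at most like \<open>e\<^bsup>r |w| |z|\<^esup>\<close>
  with \<open>r < 1\<close> (\<open>fock_inner_exchange\<close>). For \<open>0 < |A| < 1\<close> this holds for the inverse of \<open>T\<close>, and the
  polynomial factor is moved across the inner product beforehand
  (\<open>symmetric_contraction\<close>). For \<open>|A| \<ge> 1\<close> one replaces \<open>g\<close> by its dilation \<open>g (r \<cdot>)\<close> with \<open>r < 1\<close> and
  lets \<open>r\<close> tend to 1 (\<open>symmetric_expansion\<close>). The image of the dilated function is a weighted
  dilation of \<open>f\<close> about the point \<open>B\<close>; its norm stays bounded, because the Gaussian weight absorbs the
  exponential factor, and so it converges weakly to \<open>f\<close> (\<open>weighted_dilation_tendsto\<close>).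
  For \<open>A = 0\<close>, where \<open>m = 0\<close>, the relation is an operator of rank one.
\<close>

section \<open>Lebesgue measure on the plane and the Gaussian integral\<close>

lemma distr_Complex_lborel:
  "distr (lborel :: (real \<times> real) measure) borel (\<lambda>(x, y). Complex x y) = lborel"
proof (rule lborel_eqI[symmetric])
  have m [measurable]: "(\<lambda>(x, y). Complex x y) \<in> borel_measurable (borel :: (real \<times> real) measure)"
    by (intro borel_measurable_continuous_onI) (auto simp: case_prod_unfold Complex_eq intro!: continuous_intros)
  fix l u :: complex
  assume le: "\<And>b. b \<in> Basis \<Longrightarrow> l \<bullet> b \<le> u \<bullet> b"
  have "(\<lambda>(x, y). Complex x y) -` box l u = box (Re l, Im l) (Re u, Im u)"
    by (auto simp: box_def Basis_complex_def Basis_prod_def inner_complex_def)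
  moreover have "Re l \<le> Re u" "Im l \<le> Im u"
    using le[of 1] le[of \<i>] by (auto simp: Basis_complex_def inner_complex_def)
  ultimately show "emeasure (distr lborel borel (\<lambda>(x, y). Complex x y)) (box l u) = ennreal (\<Prod>b\<in>Basis. (u - l) \<bullet> b)"
    by (subst emeasure_distr) (auto simp: emeasure_lborel_box_eq Basis_complex_def Basis_prod_def inner_complex_def)
qed simp

lemma nn_integral_lborel_complex:
  assumes [measurable]: "f \<in> borel_measurable (borel :: complex measure)"
  shows "(\<integral>\<^sup>+z. f z \<partial>lborel) = (\<integral>\<^sup>+y. (\<integral>\<^sup>+x. f (Complex x y) \<partial>lborel) \<partial>lborel)"
    and "(\<integral>\<^sup>+z. f z \<partial>lborel) = (\<integral>\<^sup>+x. (\<integral>\<^sup>+y. f (Complex x y) \<partial>lborel) \<partial>lborel)"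
proof -
  have m [measurable]: "(\<lambda>(x, y). Complex x y) \<in> borel_measurable (borel :: (real \<times> real) measure)"
    by (intro borel_measurable_continuous_onI) (auto simp: case_prod_unfold Complex_eq intro!: continuous_intros)
  have *: "(\<integral>\<^sup>+z. f z \<partial>lborel) = (\<integral>\<^sup>+(x, y). f (Complex x y) \<partial>(lborel \<Otimes>\<^sub>M lborel))"
    unfolding lborel_prod using m by (subst distr_Complex_lborel[symmetric], subst nn_integral_distr) (simp_all add: case_prod_unfold)
  have m2: "(\<lambda>(x, y). f (Complex x y)) \<in> borel_measurable (lborel \<Otimes>\<^sub>M lborel)"
    using measurable_compose[OF m assms] by (simp add: case_prod_unfold lborel_prod)
  show "(\<integral>\<^sup>+z. f z \<partial>lborel) = (\<integral>\<^sup>+y. (\<integral>\<^sup>+x. f (Complex x y) \<partial>lborel) \<partial>lborel)"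
    unfolding * by (subst lborel_pair.nn_integral_snd[OF m2, symmetric]) simp
  show "(\<integral>\<^sup>+z. f z \<partial>lborel) = (\<integral>\<^sup>+x. (\<integral>\<^sup>+y. f (Complex x y) \<partial>lborel) \<partial>lborel)"
    unfolding * by (subst lborel.nn_integral_fst[OF m2, symmetric]) simp
qed

text \<open>
  A rotation is a product of three shears, and a shear preserves area by Fubini's theorem and
  the translation invariance of length. The angle \<open>\<pi>\<close>, for which the shear coefficient
  \<open>-tan (t / 2)\<close> is infinite, has to be left out.
\<close>
lemma nn_integral_rotate:
  assumes [measurable]: "f \<in> borel_measurable (borel :: complex measure)"
  assumes a: "cmod a = 1" "a \<noteq> -1"
  shows "(\<integral>\<^sup>+z. f (a * z) \<partial>lborel) = (\<integral>\<^sup>+z. f z \<partial>lborel)"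
proof -
  \<comment> \<open>This is \<open>-tan (t / 2)\<close> for \<open>a = cis t\<close>.\<close>
  define \<alpha> where "\<alpha> = - Im a / (1 + Re a)"
  have hshear: "(\<integral>\<^sup>+z. g (Complex (Re z + c * Im z) (Im z)) \<partial>lborel) = (\<integral>\<^sup>+z. g z \<partial>lborel)"
    if [measurable]: "g \<in> borel_measurable borel" for g c
  proof -
    have "(\<integral>\<^sup>+x. g (Complex x y) \<partial>lborel) = (\<integral>\<^sup>+x. g (Complex (x + c * y) y) \<partial>lborel)" for y
    proof -
      have "(\<lambda>x. g (Complex x y)) \<in> borel_measurable borel"
        unfolding Complex_eq by measurable
      from nn_integral_real_affine[OF this, of 1 "c * y"] show ?thesis by (simp add: add.commute)
    qed
    moreover have "(\<lambda>z. g (Complex (Re z + c * Im z) (Im z))) \<in> borel_measurable borel"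
      unfolding Complex_eq by measurable
    ultimately show ?thesis by (simp add: nn_integral_lborel_complex(1))
  qed
  have vshear: "(\<integral>\<^sup>+z. g (Complex (Re z) (Im z + c * Re z)) \<partial>lborel) = (\<integral>\<^sup>+z. g z \<partial>lborel)"
    if [measurable]: "g \<in> borel_measurable borel" for g c
  proof -
    have "(\<integral>\<^sup>+y. g (Complex x y) \<partial>lborel) = (\<integral>\<^sup>+y. g (Complex x (y + c * x)) \<partial>lborel)" for x
    proof -
      have "(\<lambda>y. g (Complex x y)) \<in> borel_measurable borel"
        unfolding Complex_eq by measurable
      from nn_integral_real_affine[OF this, of 1 "c * x"] show ?thesis by (simp add: add.commute)
    qed
    moreover have "(\<lambda>z. g (Complex (Re z) (Im z + c * Re z))) \<in> borel_measurable borel"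
      unfolding Complex_eq by measurable
    ultimately show ?thesis by (simp add: nn_integral_lborel_complex(2))
  qed
  have sq: "(Re a)\<^sup>2 + (Im a)\<^sup>2 = 1" using a(1) by (metis cmod_power2 one_power2)
  have ne: "1 + Re a \<noteq> 0"
  proof
    assume "1 + Re a = 0"
    then have "Re a = -1" by simp
    with sq have "Im a = 0" by simp
    with \<open>Re a = -1\<close> a(2) show False by (simp add: complex_eq_iff)
  qed
  have e1: "1 + \<alpha> * Im a = Re a"
    using ne sq by (simp add: \<alpha>_def field_simps power2_eq_square)
  have "\<alpha> * (1 + Re a) = - Im a"
    using ne by (simp add: \<alpha>_def)
  then have e2: "\<alpha> + \<alpha> * (1 + \<alpha> * Im a) = - Im a"
    unfolding e1 by (simp add: algebra_simps)
  define S where "S = (\<lambda>z. Complex (Re z + \<alpha> * Im z) (Im z))"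
  define T where "T = (\<lambda>z. Complex (Re z) (Im z + Im a * Re z))"
  have [measurable]: "S \<in> borel_measurable borel" "T \<in> borel_measurable borel"
    unfolding S_def T_def Complex_eq by measurable
  have S: "(\<integral>\<^sup>+z. g (S z) \<partial>lborel) = (\<integral>\<^sup>+z. g z \<partial>lborel)"
    if "g \<in> borel_measurable borel" for g unfolding S_def by (rule hshear) fact
  have T: "(\<integral>\<^sup>+z. g (T z) \<partial>lborel) = (\<integral>\<^sup>+z. g z \<partial>lborel)"
    if "g \<in> borel_measurable borel" for g unfolding T_def by (rule vshear) fact
  have "a * z = S (T (S z))" for z
  proof -
    have r: "(Re z + \<alpha> * Im z) + \<alpha> * (Im z + Im a * (Re z + \<alpha> * Im z))
             = (1 + \<alpha> * Im a) * Re z + (\<alpha> + \<alpha> * (1 + \<alpha> * Im a)) * Im z"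
      by (simp add: algebra_simps)
    have i: "Im z + Im a * (Re z + \<alpha> * Im z) = (1 + \<alpha> * Im a) * Im z + Im a * Re z"
      by (simp add: algebra_simps)
    show ?thesis
    proof (rule complex_eqI)
      have "Re (S (T (S z))) = (Re z + \<alpha> * Im z) + \<alpha> * (Im z + Im a * (Re z + \<alpha> * Im z))"
        by (simp add: S_def T_def)
      then show "Re (a * z) = Re (S (T (S z)))" unfolding r e2 unfolding e1 by simp
      have "Im (S (T (S z))) = Im z + Im a * (Re z + \<alpha> * Im z)"
        by (simp add: S_def T_def)
      then show "Im (a * z) = Im (S (T (S z)))" unfolding i e1 by simp
    qed
  qed
  then have "(\<integral>\<^sup>+z. f (a * z) \<partial>lborel) = (\<integral>\<^sup>+z. f (S (T (S z))) \<partial>lborel)" by simp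
  also have "\<dots> = (\<integral>\<^sup>+z. f (S (T z)) \<partial>lborel)"
    by (rule S[where g = "\<lambda>z. f (S (T z))"]) simp
  also have "\<dots> = (\<integral>\<^sup>+z. f (S z) \<partial>lborel)"
    by (rule T[where g = "\<lambda>z. f (S z)"]) simp
  also have "\<dots> = (\<integral>\<^sup>+z. f z \<partial>lborel)"
    by (rule S) simp
  finally show ?thesis .
qed

lemma lborel_distr_rotate:
  assumes "cmod a = 1"
  shows "distr lborel borel ((*) a) = lborel"
proof (rule measure_eqI)
  fix X assume "X \<in> sets (distr lborel borel ((*) a))"
  then have [measurable]: "X \<in> sets borel" by simp
  have *: "(\<integral>\<^sup>+z. indicator X (a * z) \<partial>lborel) = (\<integral>\<^sup>+z. indicator X z \<partial>lborel)"
  proof (cases "a = -1")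
    case False
    with assms show ?thesis by (intro nn_integral_rotate) auto
  next
    case True
    \<comment> \<open>The half turn is two quarter turns.\<close>
    have "(\<integral>\<^sup>+z. indicator X (a * z) \<partial>lborel) = (\<integral>\<^sup>+z. indicator X (\<i> * (\<i> * z)) \<partial>lborel)"
      by (simp add: True mult.assoc[symmetric])
    also have "\<dots> = (\<integral>\<^sup>+z. indicator X (\<i> * z) \<partial>lborel)"
      by (rule nn_integral_rotate[where f = "\<lambda>z. indicator X (\<i> * z)"]) (auto simp: complex_eq_iff)
    also have "\<dots> = (\<integral>\<^sup>+z. indicator X z \<partial>lborel)"
      by (rule nn_integral_rotate) (auto simp: complex_eq_iff)
    finally show ?thesis .
  qed
  have "emeasure (distr lborel borel ((*) a)) X = (\<integral>\<^sup>+z. indicator X z \<partial>(distr lborel borel ((*) a)))"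
    by simp
  also have "\<dots> = (\<integral>\<^sup>+z. indicator X (a * z) \<partial>lborel)"
    by (subst nn_integral_distr) auto
  finally show "emeasure (distr lborel borel ((*) a)) X = emeasure lborel X"
    using * by simp
qed simp

lemma has_bochner_integral_gaussian:
  "has_bochner_integral lborel (\<lambda>z::complex. exp (- (cmod z)\<^sup>2)) pi"
proof (rule has_bochner_integral_nn_integral)
  have g: "has_bochner_integral lborel (\<lambda>x::real. exp (- x\<^sup>2)) (sqrt pi)"
    using has_bochner_integral_even_function[OF gaussian_moment_0] by simp
  have g': "(\<integral>\<^sup>+x. ennreal (exp (- (x::real)\<^sup>2)) \<partial>lborel) = ennreal (sqrt pi)"
    using nn_integral_eq_integral[of lborel "\<lambda>x::real. exp (- x\<^sup>2)"] g
    by (simp add: has_bochner_integral_iff)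
  have "(\<integral>\<^sup>+z. ennreal (exp (- (cmod (z::complex))\<^sup>2)) \<partial>lborel)
      = (\<integral>\<^sup>+y. (\<integral>\<^sup>+x. ennreal (exp (- (x::real)\<^sup>2)) * ennreal (exp (- (y::real)\<^sup>2)) \<partial>lborel) \<partial>lborel)"
    by (subst nn_integral_lborel_complex(1))
       (auto simp: cmod_power2 exp_add[symmetric] ennreal_mult[symmetric] intro!: nn_integral_cong)
  also have "\<dots> = ennreal (sqrt pi) * ennreal (sqrt pi)"
    by (simp add: nn_integral_multc nn_integral_cmult g')
  also have "\<dots> = ennreal pi" by (simp add: ennreal_mult[symmetric])
  finally show "(\<integral>\<^sup>+z. ennreal (exp (- (cmod (z::complex))\<^sup>2)) \<partial>lborel) = ennreal pi" .
qed auto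

section \<open>Fock space as square integrable functions for a Gaussian probability measure\<close>

lemma has_bochner_integral_lborel_affine:
  fixes f :: "'a::euclidean_space \<Rightarrow> 'b::{banach, second_countable_topology}"
  assumes f: "has_bochner_integral lborel f I" and c: "c \<noteq> 0"
  shows "has_bochner_integral lborel (\<lambda>x. f (t + c *\<^sub>R x)) (I /\<^sub>R \<bar>c\<bar> ^ DIM('a))"
proof -
  have [measurable]: "f \<in> borel_measurable borel"
    using f by (auto simp: has_bochner_integral_iff)
  have "has_bochner_integral (density (distr lborel borel (\<lambda>x. t + c *\<^sub>R x)) (\<lambda>_. ennreal (\<bar>c\<bar> ^ DIM('a)))) f I"
    using f lborel_affine[OF c, of t] by (simp add: ennreal_power)
  then have "has_bochner_integral lborel (\<lambda>x. \<bar>c\<bar> ^ DIM('a) *\<^sub>R f (t + c *\<^sub>R x)) I"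
    by (simp add: has_bochner_integral_iff integrable_density integral_density integrable_distr_eq integral_distr)
  from has_bochner_integral_scaleR_right[OF this, of "inverse (\<bar>c\<bar> ^ DIM('a))"]
  show ?thesis using c by simp
qed

lemma borel_measurable_cnj [measurable]: "cnj \<in> borel_measurable borel"
  by (intro borel_measurable_continuous_onI continuous_intros)

text \<open>
  With the weight and the factor \<open>1 / \<pi>\<close> absorbed into a probability measure, the Fock space
  inner product is an inner product of square integrable functions, and bounded functions are
  integrable.
\<close>
definition gauss :: "complex measure" where
  "gauss = density lborel (\<lambda>z. ennreal (exp (- (cmod z)\<^sup>2) / pi))"

lemma sets_gauss [simp, measurable_cong]: "sets gauss = sets borel"
  and space_gauss [simp]: "space gauss = UNIV"
  by (simp_all add: gauss_def)

lemma prob_space_gauss: "prob_space gauss"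
proof
  have "emeasure gauss (space gauss) = (\<integral>\<^sup>+z. ennreal (exp (- (cmod z)\<^sup>2) / pi) \<partial>lborel)"
    by (simp add: gauss_def emeasure_density)
  also have "\<dots> = 1"
    using has_bochner_integral_divide_zero[OF has_bochner_integral_gaussian, of pi]
    by (subst nn_integral_eq_integral) (auto simp: has_bochner_integral_iff)
  finally show "emeasure gauss (space gauss) = 1" .
qed

interpretation gauss: prob_space gauss
  by (rule prob_space_gauss)

lemma integrable_gauss_iff:
  fixes f :: "complex \<Rightarrow> 'b::{banach, second_countable_topology}"
  assumes "f \<in> borel_measurable borel"
  shows "integrable gauss f \<longleftrightarrow> integrable lborel (\<lambda>z. (exp (- (cmod z)\<^sup>2) / pi) *\<^sub>R f z)"
  unfolding gauss_def using assms by (subst integrable_density) auto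

lemma integral_gauss:
  fixes f :: "complex \<Rightarrow> 'b::{banach, second_countable_topology}"
  assumes "f \<in> borel_measurable borel"
  shows "integral\<^sup>L gauss f = (LINT z|lborel. (exp (- (cmod z)\<^sup>2) / pi) *\<^sub>R f z)"
  unfolding gauss_def using assms by (subst integral_density) auto

lemma entire_borel_measurable:
  "f holomorphic_on UNIV \<Longrightarrow> f \<in> borel_measurable borel"
  by (intro borel_measurable_continuous_onI holomorphic_on_imp_continuous_on)

lemma fock_gauss:
  "f \<in> fock \<longleftrightarrow> f holomorphic_on UNIV \<and> integrable gauss (\<lambda>z. (cmod (f z))\<^sup>2)"
proof (cases "f holomorphic_on UNIV")
  case True
  note [measurable] = entire_borel_measurable[OF True]
  have "integrable gauss (\<lambda>z. (cmod (f z))\<^sup>2) \<longleftrightarrow>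
        integrable lborel (\<lambda>z. (cmod (f z))\<^sup>2 * exp (- (cmod z)\<^sup>2) * inverse pi)"
    by (subst integrable_gauss_iff) (auto simp: field_simps)
  also have "\<dots> \<longleftrightarrow> integrable lborel (\<lambda>z. (cmod (f z))\<^sup>2 * exp (- (cmod z)\<^sup>2))"
    by simp
  finally show ?thesis by (simp add: fock_def True)
qed (simp add: fock_def)

lemma fock_holomorphic: "f \<in> fock \<Longrightarrow> f holomorphic_on UNIV"
  by (simp add: fock_gauss)

lemma fock_measurable: "f \<in> fock \<Longrightarrow> f \<in> borel_measurable borel"
  by (simp add: entire_borel_measurable fock_gauss)

lemma fock_inner_gauss:
  assumes [measurable]: "f \<in> borel_measurable borel" "g \<in> borel_measurable borel"
  shows "fock_inner f g = (LINT z|gauss. f z * cnj (g z))"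
proof -
  have "(LINT z|gauss. f z * cnj (g z)) =
        (LINT z|lborel. complex_of_real (1 / pi) * (f z * cnj (g z) * complex_of_real (exp (- (cmod z)\<^sup>2))))"
    by (subst integral_gauss) (auto simp: scaleR_conv_of_real mult_ac intro!: Bochner_Integration.integral_cong)
  also have "\<dots> = fock_inner f g"
    unfolding fock_inner_def by (rule integral_mult_right_zero)
  finally show ?thesis ..
qed

lemma fock_inner_cnj: "fock_inner g f = cnj (fock_inner f g)"
  unfolding fock_inner_def complex_cnj_mult Bochner_Integration.integral_cnj[symmetric]
  by (simp add: mult_ac)

lemma integrable_mult_square_integrable:
  fixes f g :: "'a \<Rightarrow> complex"
  assumes [measurable]: "f \<in> borel_measurable M" "g \<in> borel_measurable M"
    and "integrable M (\<lambda>x. (cmod (f x))\<^sup>2)" "integrable M (\<lambda>x. (cmod (g x))\<^sup>2)"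
  shows "integrable M (\<lambda>x. f x * g x)"
proof (rule Bochner_Integration.integrable_bound)
  show "integrable M (\<lambda>x. (cmod (f x))\<^sup>2 + (cmod (g x))\<^sup>2)"
    using assms by simp
  show "AE x in M. norm (f x * g x) \<le> norm ((cmod (f x))\<^sup>2 + (cmod (g x))\<^sup>2)"
  proof (rule AE_I2)
    fix x
    have "2 * cmod (f x) * cmod (g x) \<le> (cmod (f x))\<^sup>2 + (cmod (g x))\<^sup>2"
      by (rule sum_squares_bound)
    then have "cmod (f x) * cmod (g x) \<le> (cmod (f x))\<^sup>2 + (cmod (g x))\<^sup>2"
      using mult_nonneg_nonneg[OF norm_ge_zero[of "f x"] norm_ge_zero[of "g x"]] by linarith
    then show "norm (f x * g x) \<le> norm ((cmod (f x))\<^sup>2 + (cmod (g x))\<^sup>2)"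
      by (simp add: norm_mult)
  qed
qed measurable

text \<open>The linear term costs a part of the quadratic decay that is left over by \<open>r < 1\<close>.\<close>
lemma integrable_gauss_exp:
  assumes "r < 1"
  shows "integrable gauss (\<lambda>z. exp (r * (cmod z)\<^sup>2 + c * cmod z))"
proof -
  \<comment> \<open>One half of the surplus \<open>1 - r\<close> pays for the linear term, the other half is kept.\<close>
  define s where "s = (1 - r) / 2"
  have s: "s > 0" using assms by (simp add: s_def)
  have le: "r * x\<^sup>2 + c * x - x\<^sup>2 \<le> c\<^sup>2 / (4 * s) - s * x\<^sup>2" for x
  proof -
    have "0 \<le> (2 * s * x - c)\<^sup>2 / (4 * s)" using s by simp
    also have "\<dots> = s * x\<^sup>2 - c * x + c\<^sup>2 / (4 * s)"
      using s by (simp add: field_simps power2_eq_square)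
    finally show ?thesis by (simp add: s_def field_simps)
  qed
  have "integrable lborel (\<lambda>z. exp (- (cmod (0 + sqrt s *\<^sub>R z))\<^sup>2))"
    using has_bochner_integral_lborel_affine[OF has_bochner_integral_gaussian, of "sqrt s" 0] s
    by (auto simp: has_bochner_integral_iff)
  then have "integrable lborel (\<lambda>z. exp (c\<^sup>2 / (4 * s)) / pi * exp (- (cmod (0 + sqrt s *\<^sub>R z))\<^sup>2))"
    by simp
  moreover have "exp (r * (cmod z)\<^sup>2 + c * cmod z) * exp (- (cmod z)\<^sup>2) / pi
      \<le> exp (c\<^sup>2 / (4 * s)) / pi * exp (- (cmod (0 + sqrt s *\<^sub>R z))\<^sup>2)" for z
    using le[of "cmod z"] s
    by (simp add: exp_add[symmetric] power_mult_distrib divide_right_mono)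
  ultimately show ?thesis
    by (subst integrable_gauss_iff) (auto elim!: Bochner_Integration.integrable_bound simp: mult.commute)
qed

text \<open>
  The product of two square integrable functions is integrable; the exponent \<open>r / 2\<close> is what a
  square root of an integrable \<open>e\<^bsup>r |z|\<^sup>2\<^esup>\<close> allows.
\<close>
lemma fock_integrable_exp:
  assumes "f \<in> fock" "r < 1"
  shows "integrable gauss (\<lambda>z. cmod (f z) * exp (r / 2 * (cmod z)\<^sup>2 + c * cmod z))"
proof -
  note [measurable] = fock_measurable[OF assms(1)]
  have "(exp (r / 2 * (cmod z)\<^sup>2 + c * cmod z))\<^sup>2 = exp (r * (cmod z)\<^sup>2 + (2 * c) * cmod z)" for z :: complex
    by (simp add: exp_double[symmetric] algebra_simps)
  then have "integrable gauss (\<lambda>z. f z * complex_of_real (exp (r / 2 * (cmod z)\<^sup>2 + c * cmod z)))"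
    using assms integrable_gauss_exp[OF assms(2), of "2 * c"]
    by (intro integrable_mult_square_integrable) (auto simp: fock_gauss)
  from integrable_norm[OF this] show ?thesis by (simp add: norm_mult)
qed

lemma power_le_fact_exp:
  fixes x :: real assumes "0 \<le> x" shows "x ^ n \<le> fact n * exp x"
proof -
  have "(\<lambda>n. x ^ n /\<^sub>R fact n) sums exp x" by (rule exp_converges)
  then have "x ^ n /\<^sub>R fact n \<le> exp x"
    using sum_le_suminf[of "\<lambda>n. x ^ n /\<^sub>R fact n" "{n}"] assms by (auto simp: sums_iff)
  then show ?thesis by (simp add: field_simps)
qed

lemma fock_expI:
  assumes "f holomorphic_on UNIV" "\<And>w. cmod (f w) \<le> M * exp (c * cmod w)"
  shows "f \<in> fock"
  unfolding fock_gauss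
proof
  note [measurable] = entire_borel_measurable[OF assms(1)]
  have "integrable gauss (\<lambda>z. M\<^sup>2 * exp (0 * (cmod z)\<^sup>2 + (2 * c) * cmod z))"
    by (intro integrable_mult_right integrable_gauss_exp) simp
  then show "integrable gauss (\<lambda>z. (cmod (f z))\<^sup>2)"
  proof (rule Bochner_Integration.integrable_bound)
    have "(cmod (f z))\<^sup>2 \<le> M\<^sup>2 * exp (2 * c * cmod z)" for z
    proof -
      have "(cmod (f z))\<^sup>2 \<le> (M * exp (c * cmod z))\<^sup>2"
        using assms(2)[of z] by (intro power_mono) auto
      then show ?thesis by (simp add: power_mult_distrib exp_double[symmetric] mult.assoc)
    qed
    then show "AE z in gauss. norm ((cmod (f z))\<^sup>2) \<le> norm (M\<^sup>2 * exp (0 * (cmod z)\<^sup>2 + (2 * c) * cmod z))"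
      by simp
  qed measurable
qed (fact assms(1))

lemma norm_power_times_exp_le:
  "cmod (w ^ m * exp (w * a)) \<le> fact m * exp ((1 + cmod a) * cmod w)"
proof -
  have "cmod (w ^ m * exp (w * a)) \<le> cmod w ^ m * exp (cmod w * cmod a)"
    using norm_exp[of "w * a"] by (simp add: norm_mult norm_power mult_left_mono)
  also have "\<dots> \<le> (fact m * exp (cmod w)) * exp (cmod w * cmod a)"
    by (intro mult_right_mono power_le_fact_exp) auto
  also have "\<dots> = fact m * exp ((1 + cmod a) * cmod w)"
    by (simp add: exp_add[symmetric] algebra_simps)
  finally show ?thesis .
qed

lemma fock_power_exp: "(\<lambda>w. w ^ m * exp (w * a)) \<in> fock"
  by (rule fock_expI[OF _ norm_power_times_exp_le]) (intro holomorphic_intros)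

lemma fock_exp: "(\<lambda>w. exp (w * a)) \<in> fock"
  using fock_power_exp[of 0 a] by simp

lemma fock_cmult: "f \<in> fock \<Longrightarrow> (\<lambda>w. c * f w) \<in> fock"
  by (auto simp: fock_gauss norm_mult power_mult_distrib intro!: holomorphic_intros)

lemma fock_inner_cmult_right: "fock_inner f (\<lambda>w. c * g w) = cnj c * fock_inner f g"
  unfolding fock_inner_def by (simp add: mult_ac)

section \<open>Reproducing kernels\<close>

lemma fock_integrable_square: "f \<in> fock \<Longrightarrow> integrable gauss (\<lambda>z. (cmod (f z))\<^sup>2)"
  by (simp add: fock_gauss)

lemma fock_integrable_mult_cnj:
  assumes f: "f \<in> fock" and g: "g \<in> fock"
  shows "integrable gauss (\<lambda>z. f z * cnj (g z))"
proof -
  note [measurable] = fock_measurable[OF f] fock_measurable[OF g]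
  show ?thesis
    using fock_integrable_square[OF f] fock_integrable_square[OF g]
    by (intro integrable_mult_square_integrable) simp_all
qed

lemma has_bochner_integral_gauss_rotate:
  fixes f :: "complex \<Rightarrow> 'b::{banach, second_countable_topology}"
  assumes f: "integrable gauss f" and a: "cmod a = 1"
  shows "has_bochner_integral gauss (\<lambda>z. f (a * z)) (integral\<^sup>L gauss f)"
proof -
  have [measurable]: "f \<in> borel_measurable borel"
    using borel_measurable_integrable[OF f] by simp
  have "has_bochner_integral (distr lborel borel ((*) a)) (\<lambda>z. (exp (- (cmod z)\<^sup>2) / pi) *\<^sub>R f z) (integral\<^sup>L gauss f)"
    using f unfolding lborel_distr_rotate[OF a]
    by (simp add: has_bochner_integral_iff integrable_gauss_iff integral_gauss)
  then have "has_bochner_integral lborel (\<lambda>z. (exp (- (cmod z)\<^sup>2) / pi) *\<^sub>R f (a * z)) (integral\<^sup>L gauss f)"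
    by (simp add: has_bochner_integral_iff integrable_distr_eq integral_distr norm_mult a)
  then show ?thesis
    by (simp add: has_bochner_integral_iff integrable_gauss_iff integral_gauss)
qed

lemma entire_compose:
  assumes "f holomorphic_on UNIV" "g holomorphic_on UNIV"
  shows "(\<lambda>z. f (g z)) holomorphic_on UNIV"
  using holomorphic_on_compose_gen[OF assms(2,1)] by (simp add: o_def)

lemma circle_mean_value:
  assumes "f holomorphic_on UNIV"
  shows "(LINT t:{0..1}|lborel. f (cis (2 * pi * t) * z)) = f 0"
proof -
  have hol: "(\<lambda>w. f (w * z)) holomorphic_on UNIV"
    by (intro entire_compose[OF assms] holomorphic_intros)
  then have "((\<lambda>u. f (u * z) / (u - 0)) has_contour_integral (2 * of_real pi * \<i> * f (0 * z))) (circlepath 0 1)"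
    by (intro Cauchy_integral_circlepath_simple) (auto intro: holomorphic_on_subset)
  then have "((\<lambda>t. f (circlepath 0 1 t * z) / circlepath 0 1 t * (2 * of_real pi * \<i> * exp (2 * of_real pi * \<i> * of_real t)))
     has_integral (2 * of_real pi * \<i> * f 0)) {0..1}"
    unfolding has_contour_integral_def mult_zero_left diff_zero
    by (rule has_integral_eq[rotated]) (simp add: vector_derivative_circlepath01)
  then have "((\<lambda>t. 2 * of_real pi * \<i> * f (cis (2 * pi * t) * z)) has_integral (2 * of_real pi * \<i> * f 0)) {0..1}"
    by (rule has_integral_eq[rotated]) (simp add: circlepath cis_conv_exp mult_ac)
  from has_integral_mult_right[OF this, of "inverse (2 * of_real pi * \<i>)"]
  have 1: "((\<lambda>t. f (cis (2 * pi * t) * z)) has_integral f 0) {0..1}"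
    by (simp add: field_simps)
  have "set_integrable lborel {0..1} (\<lambda>t. f (cis (2 * pi * t) * z))"
    by (intro borel_integrable_atLeastAtMost' continuous_on_compose2[OF holomorphic_on_imp_continuous_on[OF assms]] continuous_intros)
      auto
  from set_borel_integral_eq_integral(2)[OF this] 1 show ?thesis
    by (simp add: integral_unique)
qed

text \<open>
  The Gaussian measure is rotation invariant, so a function may be replaced by its average over
  circles around the origin, which by Cauchy's formula is the constant \<open>f 0\<close>.
\<close>
lemma gauss_mean_value:
  assumes f: "f holomorphic_on UNIV" "integrable gauss f"
  shows "integral\<^sup>L gauss f = f 0"
proof -
  interpret P: pair_sigma_finite lborel gauss ..
  define G where "G = (\<lambda>t z. indicator {0..1::real} t *\<^sub>R f (cis (2 * pi * t) * z))"
  have "(\<lambda>p. f (cis (2 * pi * fst p) * snd p)) \<in> borel_measurable (borel :: (real \<times> complex) measure)"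
    by (intro borel_measurable_continuous_onI continuous_on_compose2[OF holomorphic_on_imp_continuous_on[OF f(1)]] continuous_intros)
      auto
  then have [measurable]: "(\<lambda>p. f (cis (2 * pi * fst p) * snd p)) \<in> borel_measurable (lborel \<Otimes>\<^sub>M gauss)"
    by (simp add: borel_prod[symmetric] cong: measurable_cong_sets)
  have meas: "(\<lambda>(t, z). G t z) \<in> borel_measurable (lborel \<Otimes>\<^sub>M gauss)"
    unfolding G_def case_prod_unfold by measurable
  have rot: "has_bochner_integral gauss (\<lambda>z. f (cis (2 * pi * t) * z)) (integral\<^sup>L gauss f)"
      "has_bochner_integral gauss (\<lambda>z. norm (f (cis (2 * pi * t) * z))) (LINT z|gauss. norm (f z))" for t
    using has_bochner_integral_gauss_rotate[of f "cis (2 * pi * t)"]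
      has_bochner_integral_gauss_rotate[of "\<lambda>z. norm (f z)" "cis (2 * pi * t)"] f by auto
  have int: "integrable (lborel \<Otimes>\<^sub>M gauss) (\<lambda>(t, z). G t z)"
  proof (rule P.Fubini_integrable[OF meas])
    show "AE t in lborel. integrable gauss (\<lambda>z. case (t, z) of (t, z) \<Rightarrow> G t z)"
      using rot(1) by (auto simp: G_def has_bochner_integral_iff)
    have "(LINT z|gauss. norm (case (t, z) of (t, z) \<Rightarrow> G t z)) = indicator {0..1} t *\<^sub>R (LINT z|gauss. norm (f z))" for t
      using rot(2)[of t] by (simp add: G_def has_bochner_integral_iff)
    then show "integrable lborel (\<lambda>t. LINT z|gauss. norm (case (t, z) of (t, z) \<Rightarrow> G t z))"
      by simp
  qed
  have "(LINT z|gauss. (LINT t|lborel. G t z)) = (LINT t|lborel. (LINT z|gauss. G t z))"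
    using P.Fubini_integral[OF int] by simp
  also have "(\<lambda>t. LINT z|gauss. G t z) = (\<lambda>t. indicator {0..1} t *\<^sub>R integral\<^sup>L gauss f)"
    using rot(1) by (simp add: G_def has_bochner_integral_iff)
  also have "(LINT t|lborel. indicator {0..1::real} t *\<^sub>R integral\<^sup>L gauss f) = integral\<^sup>L gauss f"
    by (subst integral_scaleR_left[OF integrable_real_indicator]) auto
  also have "(\<lambda>z. LINT t|lborel. G t z) = (\<lambda>z. f 0)"
    using circle_mean_value[OF f(1)] by (simp add: G_def set_lebesgue_integral_def)
  finally show ?thesis using gauss.prob_space by simp
qed

text \<open>
  Translating by \<open>z\<close> turns the integrand against the kernel into the entire function
  \<open>f (u + z) e\<^bsup>-u cnj z\<^esup>\<close> against the Gaussian, and the mean value theorem applies at \<open>u = 0\<close>.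
\<close>
lemma fock_reproducing:
  assumes f: "f \<in> fock"
  shows "fock_inner f (\<lambda>w. exp (w * cnj z)) = f z"
proof -
  note hol = fock_holomorphic[OF f]
  note [measurable] = fock_measurable[OF f]
  have m2 [measurable]: "(\<lambda>w. exp (w * cnj z)) \<in> borel_measurable borel"
    by (rule fock_measurable[OF fock_exp])
  define g where "g = (\<lambda>u. f (u + z) * exp (- (cnj z * u)))"
  have ghol: "g holomorphic_on UNIV"
    unfolding g_def by (intro entire_compose[OF hol] holomorphic_intros)
  note [measurable] = entire_borel_measurable[OF ghol]
  have "integrable gauss (\<lambda>w. f w * cnj (exp (w * cnj z)))"
    by (intro fock_integrable_mult_cnj f fock_exp)
  then have "has_bochner_integral lborel (\<lambda>w. (exp (- (cmod w)\<^sup>2) / pi) *\<^sub>R (f w * cnj (exp (w * cnj z))))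
     (fock_inner f (\<lambda>w. exp (w * cnj z)))"
    by (simp add: has_bochner_integral_iff integrable_gauss_iff fock_inner_gauss integral_gauss)
  from has_bochner_integral_lborel_affine[OF this, of 1 z]
  have "has_bochner_integral lborel (\<lambda>u. (exp (- (cmod (z + u))\<^sup>2) / pi) *\<^sub>R (f (z + u) * cnj (exp ((z + u) * cnj z))))
     (fock_inner f (\<lambda>w. exp (w * cnj z)))"
    by simp
  also have "(\<lambda>u. (exp (- (cmod (z + u))\<^sup>2) / pi) *\<^sub>R (f (z + u) * cnj (exp ((z + u) * cnj z)))) =
    (\<lambda>u. (exp (- (cmod u)\<^sup>2) / pi) *\<^sub>R g u)"
  proof
    fix u
    have "complex_of_real (exp (- (cmod (z + u))\<^sup>2)) * cnj (exp ((z + u) * cnj z))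
        = exp (of_real (- (cmod (z + u))\<^sup>2) + cnj ((z + u) * cnj z))"
      by (simp only: exp_add exp_of_real exp_cnj)
    also have "of_real (- (cmod (z + u))\<^sup>2) + cnj ((z + u) * cnj z) = of_real (- (cmod u)\<^sup>2) + (- (cnj z * u))"
      by (simp only: of_real_minus complex_norm_square) (simp add: algebra_simps)
    finally have "complex_of_real (exp (- (cmod (z + u))\<^sup>2)) * cnj (exp ((z + u) * cnj z)) =
       complex_of_real (exp (- (cmod u)\<^sup>2)) * exp (- (cnj z * u))"
      by (simp only: exp_add exp_of_real)
    then show "(exp (- (cmod (z + u))\<^sup>2) / pi) *\<^sub>R (f (z + u) * cnj (exp ((z + u) * cnj z))) =
       (exp (- (cmod u)\<^sup>2) / pi) *\<^sub>R g u"
      by (simp add: g_def scaleR_conv_of_real add.commute mult_ac)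
  qed
  finally have "has_bochner_integral gauss g (fock_inner f (\<lambda>w. exp (w * cnj z)))"
    by (simp add: has_bochner_integral_iff integrable_gauss_iff integral_gauss)
  then show ?thesis
    using gauss_mean_value[OF ghol] by (simp add: has_bochner_integral_iff g_def)
qed

lemma norm_exp_minus_one_le: "cmod (exp z - 1) \<le> cmod z * exp (cmod z)"
proof -
  have "norm (exp z - exp 0) \<le> exp (cmod z) * norm (z - 0)"
  proof (rule differentiable_bound[of "closed_segment 0 z" exp "\<lambda>w h. exp w * h"])
    show "(exp has_derivative (\<lambda>h. exp w * h)) (at w within closed_segment 0 z)" for w
      using DERIV_exp[of w] by (auto simp: has_field_derivative_def intro: has_derivative_at_withinI)
    show "onorm (\<lambda>h. exp w * h) \<le> exp (cmod z)" if "w \<in> closed_segment 0 z" for w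
    proof (rule onorm_le)
      have "cmod w \<le> cmod z" using that segment_bound1[of w 0 z] by simp
      then have "cmod (exp w) \<le> exp (cmod z)" using norm_exp[of w] by (meson exp_le_cancel_iff order_trans)
      then show "norm (exp w * h) \<le> exp (cmod z) * norm h" for h by (simp add: norm_mult mult_right_mono)
    qed
  qed auto
  then show ?thesis by (simp add: mult.commute)
qed

text \<open>
  Differentiation under the integral sign. The difference quotients of the kernel are dominated
  by a constant multiple of \<open>e\<^bsup>C |w|\<^esup>\<close>, which is integrable against every function in Fock space.
\<close>
lemma has_field_derivative_fock_inner_kernel:
  assumes f: "f \<in> fock"
  shows "((\<lambda>z. fock_inner f (\<lambda>w. w ^ m * exp (w * cnj z))) has_field_derivative
          fock_inner f (\<lambda>w. w ^ Suc m * exp (w * cnj z))) (at z)"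
  unfolding DERIV_def tendsto_at_iff_sequentially
proof (intro allI impI)
  note [measurable] = fock_measurable[OF f]
  have mk [measurable]: "(\<lambda>w. w ^ m * exp (w * a)) \<in> borel_measurable borel" for m and a :: complex
    by (rule fock_measurable[OF fock_power_exp])
  define k where "k = (\<lambda>z w. f w * cnj (w ^ m * exp (w * cnj z)))"
  have ki: "integrable gauss (k z)" for z
    unfolding k_def by (intro fock_integrable_mult_cnj f fock_power_exp)
  have km [measurable]: "k z \<in> borel_measurable borel" for z
    unfolding k_def by measurable
  have kI: "fock_inner f (\<lambda>w. w ^ m * exp (w * cnj z)) = integral\<^sup>L gauss (k z)" for z
    by (simp add: fock_inner_gauss k_def)
  fix X assume X: "\<forall>i. X i \<in> UNIV - {0}" "X \<longlonglongrightarrow> (0::complex)"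
  then have X0: "X i \<noteq> 0" for i by auto
  obtain K where K: "\<And>i. cmod (X i) \<le> K"
    using convergent_imp_Bseq[OF convergentI[OF X(2)]] by (auto simp: Bseq_def)
  have K0: "0 \<le> K" using K[of 0] norm_ge_zero order_trans by blast
  have q: "(k (z + h) w - k z w) / h = k z w * ((exp (cnj w * h) - 1) / h)" for w h
  proof -
    have "k (z + h) w = k z w * exp (cnj w * h)"
      by (simp add: k_def exp_cnj distrib_left exp_add mult_ac)
    then show ?thesis by (simp add: diff_divide_distrib right_diff_distrib)
  qed
  have lim: "(\<lambda>i. LINT w|gauss. k z w * ((exp (cnj w * X i) - 1) / X i)) \<longlonglongrightarrow> (LINT w|gauss. f w * cnj (w ^ Suc m * exp (w * cnj z)))"
  proof (rule integral_dominated_convergence)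
    show "integrable gauss (\<lambda>w. fact (Suc m) * (cmod (f w) * exp (0 / 2 * (cmod w)\<^sup>2 + (1 + cmod z + K) * cmod w)))"
      by (intro integrable_mult_right fock_integrable_exp f) simp
    show "AE w in gauss. (\<lambda>i. k z w * ((exp (cnj w * X i) - 1) / X i)) \<longlonglongrightarrow> f w * cnj (w ^ Suc m * exp (w * cnj z))"
    proof (rule AE_I2)
      fix w
      have "((\<lambda>h. exp (cnj w * h)) has_field_derivative exp (cnj w * 0) * cnj w) (at 0)"
        by (auto intro!: derivative_eq_intros)
      then have "(\<lambda>h. (exp (cnj w * h) - 1) / h) \<midarrow>0\<rightarrow> cnj w"
        by (simp add: has_field_derivative_iff)
      then have "(\<lambda>i. (exp (cnj w * X i) - 1) / X i) \<longlonglongrightarrow> cnj w"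
        using X by (auto simp: tendsto_at_iff_sequentially o_def)
      then have "(\<lambda>i. k z w * ((exp (cnj w * X i) - 1) / X i)) \<longlonglongrightarrow> k z w * cnj w"
        by (intro tendsto_intros)
      then show "(\<lambda>i. k z w * ((exp (cnj w * X i) - 1) / X i)) \<longlonglongrightarrow> f w * cnj (w ^ Suc m * exp (w * cnj z))"
        by (simp add: k_def mult_ac)
    qed
    show "AE w in gauss. norm (k z w * ((exp (cnj w * X i) - 1) / X i))
        \<le> fact (Suc m) * (cmod (f w) * exp (0 / 2 * (cmod w)\<^sup>2 + (1 + cmod z + K) * cmod w))" for i
    proof (rule AE_I2)
      fix w
      have "cmod ((exp (cnj w * X i) - 1) / X i) \<le> cmod w * exp (cmod w * cmod (X i))"
        using norm_exp_minus_one_le[of "cnj w * X i"] X0[of i] by (simp add: norm_divide norm_mult divide_le_eq mult_ac)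
      also have "\<dots> \<le> cmod w * exp (K * cmod w)"
        using K[of i] by (auto intro!: mult_left_mono simp: mult.commute[of K])
      finally have "norm (k z w * ((exp (cnj w * X i) - 1) / X i)) \<le> norm (k z w) * (cmod w * exp (K * cmod w))"
        unfolding norm_mult by (intro mult_left_mono) (auto simp: norm_mult norm_divide)
      also have "\<dots> = cmod (f w) * cmod (w ^ Suc m * exp (w * cnj z)) * exp (K * cmod w)"
        by (simp add: k_def norm_mult norm_power exp_cnj)
      also have "\<dots> \<le> cmod (f w) * (fact (Suc m) * exp ((1 + cmod (cnj z)) * cmod w)) * exp (K * cmod w)"
        by (intro mult_left_mono mult_right_mono norm_power_times_exp_le) auto
      also have "\<dots> = fact (Suc m) * (cmod (f w) * exp (0 / 2 * (cmod w)\<^sup>2 + (1 + cmod z + K) * cmod w))"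
      proof -
        have "exp ((1 + cmod (cnj z)) * cmod w) * exp (K * cmod w) = exp (0 / 2 * (cmod w)\<^sup>2 + (1 + cmod z + K) * cmod w)"
          by (simp add: exp_add[symmetric] algebra_simps)
        then show ?thesis by (simp only: mult_ac)
      qed
      finally show "norm (k z w * ((exp (cnj w * X i) - 1) / X i))
        \<le> fact (Suc m) * (cmod (f w) * exp (0 / 2 * (cmod w)\<^sup>2 + (1 + cmod z + K) * cmod w))" .
    qed
  qed measurable
  have quot: "(LINT w|gauss. k z w * ((exp (cnj w * X i) - 1) / X i)) =
     (integral\<^sup>L gauss (k (z + X i)) - integral\<^sup>L gauss (k z)) / X i" for i
    unfolding q[symmetric] by (simp add: ki)
  have "fock_inner f (\<lambda>w. w ^ Suc m * exp (w * cnj z)) = (LINT w|gauss. f w * cnj (w ^ Suc m * exp (w * cnj z)))"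
    by (rule fock_inner_gauss[OF fock_measurable[OF f] mk])
  with lim show "((\<lambda>h. (fock_inner f (\<lambda>w. w ^ m * exp (w * cnj (z + h))) - fock_inner f (\<lambda>w. w ^ m * exp (w * cnj z))) / h) \<circ> X)
      \<longlonglongrightarrow> fock_inner f (\<lambda>w. w ^ Suc m * exp (w * cnj z))"
    unfolding kI o_def quot by (simp only:)
qed

lemma fock_reproducing_deriv:
  assumes f: "f \<in> fock"
  shows "fock_inner f (\<lambda>w. w ^ m * exp (w * cnj z)) = (deriv ^^ m) f z"
proof (induction m arbitrary: z)
  case 0
  then show ?case using fock_reproducing[OF f] by simp
next
  case (Suc m)
  have "((deriv ^^ m) f has_field_derivative fock_inner f (\<lambda>w. w ^ Suc m * exp (w * cnj z))) (at z)"
    using has_field_derivative_fock_inner_kernel[OF f, of m z] unfolding Suc.IH .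
  then show ?case by (simp add: DERIV_imp_deriv del: power_Suc)
qed

text \<open>
  The hypothesis \<open>r < 1\<close> makes the double integral converge absolutely for all \<open>f\<close> and \<open>g\<close>
  in Fock space: \<open>r |w| |z|\<close> is at most \<open>r (|w|\<^sup>2 + |z|\<^sup>2) / 2\<close>, so that the variables separate.
\<close>
lemma fock_inner_exchange:
  fixes k :: "complex \<Rightarrow> complex \<Rightarrow> complex"
  assumes f: "f \<in> fock" and g: "g \<in> fock"
    and cont: "continuous_on UNIV (\<lambda>p. k (fst p) (snd p))"
    and bound: "\<And>w z. cmod (k w z) \<le> M * exp (r * (cmod w * cmod z) + c * cmod w + c * cmod z)"
    and r: "0 \<le> r" "r < 1"
  shows "fock_inner (\<lambda>w. fock_inner f (\<lambda>z. cnj (k w z))) g =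
         fock_inner f (\<lambda>z. fock_inner g (\<lambda>w. k w z))"
proof -
  interpret P: pair_sigma_finite gauss gauss ..
  note [measurable] = fock_measurable[OF f] fock_measurable[OF g]
  have "(\<lambda>p. k (fst p) (snd p)) \<in> borel_measurable borel"
    using cont by (rule borel_measurable_continuous_onI)
  then have [measurable]: "(\<lambda>p. k (fst p) (snd p)) \<in> borel_measurable (borel \<Otimes>\<^sub>M borel)"
    by (simp add: borel_prod)
  have "(\<lambda>p. k (snd p) (fst p)) \<in> borel_measurable borel"
    by (intro borel_measurable_continuous_onI continuous_on_compose2[OF cont, of UNIV "\<lambda>p. (snd p, fst p)", simplified] continuous_intros)
  then have [measurable]: "(\<lambda>p. k (snd p) (fst p)) \<in> borel_measurable (borel \<Otimes>\<^sub>M borel)"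
    by (simp add: borel_prod)
  have k1 [measurable]: "k w \<in> borel_measurable borel" for w
    by (intro borel_measurable_continuous_onI continuous_on_compose2[OF cont, of UNIV "\<lambda>z. (w, z)", simplified]) (auto intro!: continuous_intros)
  have k2 [measurable]: "(\<lambda>w. k w z) \<in> borel_measurable borel" for z
    by (intro borel_measurable_continuous_onI continuous_on_compose2[OF cont, of UNIV "\<lambda>w. (w, z)", simplified]) (auto intro!: continuous_intros)
  define H where "H = (\<lambda>w z. f z * k w z * cnj (g w))"
  have Hm [measurable]: "(\<lambda>(w, z). H w z) \<in> borel_measurable (gauss \<Otimes>\<^sub>M gauss)"
    unfolding H_def case_prod_unfold by measurable
  define F where "F = (\<lambda>z. cmod (f z) * exp (r / 2 * (cmod z)\<^sup>2 + c * cmod z))"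
  define G where "G = (\<lambda>z. cmod (g z) * exp (r / 2 * (cmod z)\<^sup>2 + c * cmod z))"
  have FG: "integrable gauss F" "integrable gauss G"
    unfolding F_def G_def by (intro fock_integrable_exp f g r)+
  have "integrable (gauss \<Otimes>\<^sub>M gauss) (\<lambda>(w, z). G w * (M * F z))"
  proof (rule P.Fubini_integrable)
    have "(LINT z|gauss. norm (G w * (M * F z))) = \<bar>G w\<bar> * (\<bar>M\<bar> * (LINT z|gauss. \<bar>F z\<bar>))" for w
      by (simp add: abs_mult)
    then show "integrable gauss (\<lambda>w. LINT z|gauss. norm (case (w, z) of (w, z) \<Rightarrow> G w * (M * F z)))"
      using FG by simp
    show "AE w in gauss. integrable gauss (\<lambda>z. case (w, z) of (w, z) \<Rightarrow> G w * (M * F z))"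
      using FG by simp
    show "(\<lambda>(w, z). G w * (M * F z)) \<in> borel_measurable (gauss \<Otimes>\<^sub>M gauss)"
      unfolding F_def G_def case_prod_unfold by measurable
  qed
  then have int: "integrable (gauss \<Otimes>\<^sub>M gauss) (\<lambda>(w, z). H w z)"
  proof (rule Bochner_Integration.integrable_bound)
    have "cmod (H w z) \<le> G w * (M * F z)" for w z
    proof -
      have M0: "0 \<le> M" using order_trans[OF norm_ge_zero bound[of 0 0]] by simp
      have "r * (cmod w * cmod z) \<le> r * ((cmod w)\<^sup>2 / 2 + (cmod z)\<^sup>2 / 2)"
        using sum_squares_bound[of "cmod w" "cmod z"] r by (intro mult_left_mono) auto
      then have "cmod (k w z) \<le> M * exp ((r / 2 * (cmod w)\<^sup>2 + c * cmod w) + (r / 2 * (cmod z)\<^sup>2 + c * cmod z))"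
        by (intro order_trans[OF bound] mult_left_mono M0) (simp add: algebra_simps)
      then have "cmod (f z) * cmod (k w z) * cmod (g w) \<le>
         cmod (f z) * (M * exp ((r / 2 * (cmod w)\<^sup>2 + c * cmod w) + (r / 2 * (cmod z)\<^sup>2 + c * cmod z))) * cmod (g w)"
        by (intro mult_left_mono mult_right_mono) auto
      also have "\<dots> = G w * (M * F z)"
        unfolding F_def G_def exp_add by (simp add: mult_ac)
      finally show ?thesis by (simp add: H_def norm_mult)
    qed
    then show "AE p in gauss \<Otimes>\<^sub>M gauss. norm (case p of (w, z) \<Rightarrow> H w z) \<le> norm (case p of (w, z) \<Rightarrow> G w * (M * F z))"
      by (auto simp: case_prod_unfold intro!: AE_I2 order_trans[OF _ abs_ge_self])
  qed measurable
  have m1 [measurable]: "(\<lambda>w. fock_inner f (\<lambda>z. cnj (k w z))) \<in> borel_measurable borel"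
    by (subst fock_inner_gauss) (measurable)
  have m2 [measurable]: "(\<lambda>z. fock_inner g (\<lambda>w. k w z)) \<in> borel_measurable borel"
    by (subst fock_inner_gauss) (measurable)
  have "fock_inner (\<lambda>w. fock_inner f (\<lambda>z. cnj (k w z))) g = (LINT w|gauss. (LINT z|gauss. H w z))"
    by (simp add: fock_inner_gauss H_def)
  also have "\<dots> = (LINT z|gauss. (LINT w|gauss. H w z))"
    using P.Fubini_integral[OF int] by simp
  also have "\<dots> = fock_inner f (\<lambda>z. fock_inner g (\<lambda>w. k w z))"
    by (simp add: fock_inner_gauss H_def mult_ac flip: Bochner_Integration.integral_cnj)
  finally show ?thesis .
qed

section \<open>Weak convergence of dilations\<close>

text \<open>
  Bounded sequences that converge pointwise converge weakly. On a large disc dominated convergence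
  applies; outside of it \<open>g\<close> is small in norm and the differences \<open>d n\<close> are bounded in norm, so that
  the weighted inequality \<open>a b \<le> \<eta> a\<^sup>2 + b\<^sup>2 / \<eta>\<close> suffices.
\<close>
lemma fock_inner_tendsto_weak:
  assumes F: "\<And>n. F n \<in> fock" and f: "f \<in> fock" and g: "g \<in> fock"
    and lim: "\<And>z. (\<lambda>n. F n z) \<longlonglongrightarrow> f z"
    and bound: "\<And>n. (LINT z|gauss. (cmod (F n z))\<^sup>2) \<le> M"
    and locb: "\<And>\<rho>. \<exists>C. \<forall>n z. cmod z \<le> \<rho> \<longrightarrow> cmod (F n z) \<le> C"
  shows "(\<lambda>n. fock_inner (F n) g) \<longlonglongrightarrow> fock_inner f g"
proof -
  note [measurable] = fock_measurable[OF F] fock_measurable[OF f] fock_measurable[OF g]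
  define d where "d = (\<lambda>n z. F n z - f z)"
  have [measurable]: "d n \<in> borel_measurable borel" for n unfolding d_def by measurable
  define N where "N = 2 * M + 2 * (LINT z|gauss. (cmod (f z))\<^sup>2)"
  have dsq: "(cmod (d n z))\<^sup>2 \<le> 2 * (cmod (F n z))\<^sup>2 + 2 * (cmod (f z))\<^sup>2" for n z
  proof -
    have "(cmod (d n z))\<^sup>2 \<le> (cmod (F n z) + cmod (f z))\<^sup>2"
      unfolding d_def by (intro power_mono norm_triangle_ineq4) auto
    also have "\<dots> \<le> 2 * (cmod (F n z))\<^sup>2 + 2 * (cmod (f z))\<^sup>2"
      using sum_squares_bound[of "cmod (F n z)" "cmod (f z)"] by (simp add: power2_sum)
    finally show ?thesis .
  qed
  have dint: "integrable gauss (\<lambda>z. 2 * (cmod (F n z))\<^sup>2 + 2 * (cmod (f z))\<^sup>2)" for n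
    using fock_integrable_square[OF F] fock_integrable_square[OF f] by simp
  have dsqi: "integrable gauss (\<lambda>z. (cmod (d n z))\<^sup>2)" for n
    by (rule Bochner_Integration.integrable_bound[OF dint[of n]]) (use dsq in auto)
  have dN: "(LINT z|gauss. (cmod (d n z))\<^sup>2) \<le> N" for n
  proof -
    have "(LINT z|gauss. (cmod (d n z))\<^sup>2) \<le> (LINT z|gauss. 2 * (cmod (F n z))\<^sup>2 + 2 * (cmod (f z))\<^sup>2)"
      by (intro integral_mono dsqi dint dsq)
    also have "\<dots> \<le> N"
      using bound[of n] fock_integrable_square[OF F] fock_integrable_square[OF f] by (simp add: N_def)
    finally show ?thesis .
  qed
  have N0: "0 \<le> N" by (rule order_trans[OF _ dN[of 0]]) simp
  have gi: "integrable gauss (\<lambda>z. (cmod (g z))\<^sup>2)" by (rule fock_integrable_square[OF g])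
  have gi1: "integrable gauss (\<lambda>z. cmod (g z))"
    using fock_integrable_exp[OF g, of 0 0] by simp
  define A where "A = (\<lambda>k n. LINT z|gauss. indicator (cball 0 (real k)) z * (cmod (d n z) * cmod (g z)))"
  define B where "B = (\<lambda>k. LINT z|gauss. indicator (- cball 0 (real k)) z * (cmod (g z))\<^sup>2)"
  have [measurable]: "cball (0::complex) (real k) \<in> sets borel" for k by simp
  have Alim: "A k \<longlonglongrightarrow> 0" for k
  proof -
    obtain C where C: "\<And>n z. cmod z \<le> real k \<Longrightarrow> cmod (F n z) \<le> C" using locb[of "real k"] by blast
    have C': "cmod (f z) \<le> C" if "cmod z \<le> real k" for z
      using C[OF that] by (intro LIMSEQ_le_const2[OF tendsto_norm[OF lim[of z]]]) auto
    have "A k \<longlonglongrightarrow> (LINT z|gauss. 0)"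
      unfolding A_def
    proof (rule integral_dominated_convergence)
      show "integrable gauss (\<lambda>z. 2 * C * cmod (g z))" using gi1 by simp
      show "AE z in gauss. (\<lambda>n. indicator (cball 0 (real k)) z * (cmod (d n z) * cmod (g z))) \<longlonglongrightarrow> 0"
      proof (rule AE_I2)
        fix z
        have "(\<lambda>n. d n z) \<longlonglongrightarrow> f z - f z" unfolding d_def by (intro tendsto_intros lim)
        then have "(\<lambda>n. indicator (cball 0 (real k)) z * (cmod (d n z) * cmod (g z))) \<longlonglongrightarrow>
            indicator (cball 0 (real k)) z * (cmod (f z - f z) * cmod (g z))"
          by (intro tendsto_intros)
        then show "(\<lambda>n. indicator (cball 0 (real k)) z * (cmod (d n z) * cmod (g z))) \<longlonglongrightarrow> 0" by simp
      qed
      show "AE z in gauss. norm (indicator (cball 0 (real k)) z * (cmod (d n z) * cmod (g z))) \<le> 2 * C * cmod (g z)" for n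
      proof (rule AE_I2)
        fix z
        have "cmod (d n z) \<le> 2 * C" if "cmod z \<le> real k"
          using norm_triangle_ineq4[of "F n z" "f z"] C[OF that, of n] C'[OF that] by (simp add: d_def)
        moreover have "0 \<le> C" using order_trans[OF norm_ge_zero C[of 0]] by simp
        ultimately show "norm (indicator (cball 0 (real k)) z * (cmod (d n z) * cmod (g z))) \<le> 2 * C * cmod (g z)"
          by (auto simp: indicator_def intro!: mult_right_mono)
      qed
    qed measurable
    then show ?thesis by simp
  qed
  have Blim: "B \<longlonglongrightarrow> 0"
  proof -
    have "B \<longlonglongrightarrow> (LINT z|gauss. 0)"
      unfolding B_def
    proof (rule integral_dominated_convergence[OF _ _ gi])
      show "AE z in gauss. (\<lambda>k. indicator (- cball 0 (real k)) z * (cmod (g z))\<^sup>2) \<longlonglongrightarrow> 0"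
      proof (rule AE_I2)
        fix z :: complex
        obtain k0 where "cmod z \<le> real k0" using real_arch_simple by blast
        then have "\<forall>\<^sub>F k in sequentially. indicator (- cball 0 (real k)) z * (cmod (g z))\<^sup>2 = 0"
          by (intro eventually_sequentiallyI[of k0]) (auto simp: indicator_def)
        then show "(\<lambda>k. indicator (- cball 0 (real k)) z * (cmod (g z))\<^sup>2) \<longlonglongrightarrow> 0"
          by (rule tendsto_eventually)
      qed
    qed (auto simp: indicator_def)
    then show ?thesis by simp
  qed
  have main: "cmod (fock_inner (F n) g - fock_inner f g) \<le> A k n + (\<eta> * N + B k / \<eta>)" if \<eta>: "\<eta> > 0" for k n \<eta>
  proof -
    have dgi: "integrable gauss (\<lambda>z. cmod (d n z) * cmod (g z))"
      using integrable_norm[OF integrable_mult_square_integrable[OF _ _ dsqi[of n] gi]] by (simp add: norm_mult)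
    have int1: "integrable gauss (\<lambda>z. indicator (cball 0 (real k)) z * (cmod (d n z) * cmod (g z)))"
      by (rule Bochner_Integration.integrable_bound[OF dgi]) (auto simp: indicator_def)
    have int2: "integrable gauss (\<lambda>z. indicator (- cball 0 (real k)) z * (cmod (g z))\<^sup>2)"
      by (rule Bochner_Integration.integrable_bound[OF gi]) (auto simp: indicator_def)
    have "fock_inner (F n) g - fock_inner f g = (LINT z|gauss. d n z * cnj (g z))"
      using fock_integrable_mult_cnj[OF F g] fock_integrable_mult_cnj[OF f g]
      by (simp add: fock_inner_gauss d_def left_diff_distrib)
    also have "cmod \<dots> \<le> (LINT z|gauss. norm (d n z * cnj (g z)))"
      by (rule integral_norm_bound)
    also have "\<dots> = (LINT z|gauss. cmod (d n z) * cmod (g z))" by (simp add: norm_mult)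
    also have "\<dots> \<le> (LINT z|gauss. indicator (cball 0 (real k)) z * (cmod (d n z) * cmod (g z)) +
         (\<eta> * (cmod (d n z))\<^sup>2 + (indicator (- cball 0 (real k)) z * (cmod (g z))\<^sup>2) / \<eta>))"
    proof (intro integral_mono dgi Bochner_Integration.integrable_add int1 integrable_mult_right dsqi integrable_divide int2)
      fix z
      have "cmod (d n z) * cmod (g z) \<le> \<eta> * (cmod (d n z))\<^sup>2 + (cmod (g z))\<^sup>2 / \<eta>"
      proof -
        have "0 \<le> (\<eta> * cmod (d n z) - cmod (g z))\<^sup>2 / \<eta> + cmod (d n z) * cmod (g z)"
          using \<eta> by simp
        also have "\<dots> = \<eta> * (cmod (d n z))\<^sup>2 + (cmod (g z))\<^sup>2 / \<eta> - cmod (d n z) * cmod (g z)"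
          using \<eta> by (simp add: field_simps power2_eq_square)
        finally show ?thesis by simp
      qed
      then show "cmod (d n z) * cmod (g z) \<le> indicator (cball 0 (real k)) z * (cmod (d n z) * cmod (g z)) +
         (\<eta> * (cmod (d n z))\<^sup>2 + (indicator (- cball 0 (real k)) z * (cmod (g z))\<^sup>2) / \<eta>)"
        using \<eta> by (auto simp: indicator_def)
    qed
    also have "\<dots> = A k n + (\<eta> * (LINT z|gauss. (cmod (d n z))\<^sup>2) + B k / \<eta>)"
      unfolding A_def B_def using int1 int2 dsqi[of n] by simp
    also have "\<dots> \<le> A k n + (\<eta> * N + B k / \<eta>)"
      using dN[of n] \<eta> by (simp add: mult_left_mono)
    finally show ?thesis .
  qed
  show ?thesis
  proof (rule LIMSEQ_I)
    fix \<epsilon> :: real assume "\<epsilon> > 0"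
    \<comment> \<open>The summand 1 covers the case that the norm bound \<open>N\<close> is zero.\<close>
    define \<eta> where "\<eta> = \<epsilon> / (3 * (N + 1))"
    have \<eta>: "\<eta> > 0" using \<open>\<epsilon> > 0\<close> N0 by (simp add: \<eta>_def)
    have "\<eta> * N < \<epsilon> / 3" using \<open>\<epsilon> > 0\<close> N0 by (simp add: \<eta>_def field_simps)
    have "(\<lambda>k. B k / \<eta>) \<longlonglongrightarrow> 0 / \<eta>" by (intro tendsto_intros Blim) (use \<eta> in auto)
    then have "\<forall>\<^sub>F k in sequentially. B k / \<eta> < \<epsilon> / 3"
      using \<open>\<epsilon> > 0\<close> by (intro order_tendstoD) auto
    then obtain k where k: "B k / \<eta> < \<epsilon> / 3" by (auto simp: eventually_sequentially)
    have "\<forall>\<^sub>F n in sequentially. A k n < \<epsilon> / 3"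
      using \<open>\<epsilon> > 0\<close> by (intro order_tendstoD[OF Alim]) auto
    then obtain n0 where n0: "\<And>n. n \<ge> n0 \<Longrightarrow> A k n < \<epsilon> / 3" by (auto simp: eventually_sequentially)
    show "\<exists>no. \<forall>n\<ge>no. norm (fock_inner (F n) g - fock_inner f g) < \<epsilon>"
    proof (intro exI[of _ n0] allI impI)
      fix n assume "n \<ge> n0"
      from main[OF \<eta>, of n k] n0[OF this] k \<open>\<eta> * N < \<epsilon> / 3\<close>
      show "norm (fock_inner (F n) g - fock_inner f g) < \<epsilon>" by linarith
    qed
  qed
qed

text \<open>
  With \<open>d = x - p\<close> and \<open>s = 1 - r\<close>, both the exponent of the factor \<open>e\<^bsup>2 s |d| |b|\<^esup>\<close> and the change of the
  Gaussian weight from \<open>x\<close> to the dilated point are of order \<open>s\<close>. The latter contains \<open>-s |d|\<^sup>2\<close>,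
  which beats all terms that are linear in \<open>|d|\<close>. The bound is uniform in \<open>r\<close>.
\<close>
lemma weighted_dilation_weight:
  fixes x p b :: complex
  assumes r: "0 \<le> r" "r \<le> 1"
  shows "2 * ((1 - r) * cmod (x - p) * cmod b) - (cmod x)\<^sup>2 \<le> (cmod p + cmod b)\<^sup>2 - (cmod (p + of_real r * (x - p)))\<^sup>2"
proof -
  define d where "d = x - p"
  define s where "s = 1 - r"
  define R where "R = Re (p * cnj d)"
  have s: "0 \<le> s" "s \<le> 1" using r by (auto simp: s_def)
  have sq: "(cmod (p + of_real c * d))\<^sup>2 = (cmod p)\<^sup>2 + c\<^sup>2 * (cmod d)\<^sup>2 + 2 * c * R" for c
    unfolding cmod_power2 by (simp add: R_def power2_eq_square algebra_simps)
  have x: "(cmod x)\<^sup>2 = (cmod p)\<^sup>2 + (cmod d)\<^sup>2 + 2 * R"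
    using sq[of 1] by (simp add: d_def)
  have R: "- R \<le> cmod p * cmod d"
    using complex_Re_le_cmod[of "- (p * cnj d)"] by (simp add: R_def norm_mult)
  have "0 \<le> (cmod p + cmod b - cmod d)\<^sup>2" by simp
  then have "2 * (cmod p + cmod b) * cmod d - (cmod d)\<^sup>2 \<le> (cmod p + cmod b)\<^sup>2"
    by (simp add: power2_eq_square algebra_simps)
  then have "s * (2 * (cmod p + cmod b) * cmod d - (cmod d)\<^sup>2) \<le> s * (cmod p + cmod b)\<^sup>2"
    using s by (intro mult_left_mono)
  also have "\<dots> \<le> (cmod p + cmod b)\<^sup>2" using s by (intro mult_left_le_one_le) auto
  finally have 1: "s * (2 * (cmod p + cmod b) * cmod d - (cmod d)\<^sup>2) \<le> (cmod p + cmod b)\<^sup>2" .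
  have 2: "s * (- R) \<le> s * (cmod p * cmod d)" using R s by (intro mult_left_mono)
  have 3: "0 \<le> r * s * (cmod d)\<^sup>2" using r s by simp
  have "2 * (s * cmod d * cmod b) - (cmod x)\<^sup>2 + (cmod (p + of_real r * d))\<^sup>2
     = s * (2 * (cmod p + cmod b) * cmod d - (cmod d)\<^sup>2) - r * s * (cmod d)\<^sup>2 + 2 * (s * (- R) - s * (cmod p * cmod d))"
    unfolding x sq s_def by (simp add: power2_eq_square algebra_simps)
  also have "\<dots> \<le> (cmod p + cmod b)\<^sup>2"
  proof -
    have "X - Z + 2 * (Y - Y') \<le> K" if "X \<le> K" "Y \<le> Y'" "0 \<le> Z" for X Y Y' Z K :: real
    proof -
      have "X - Z \<le> K" "2 * (Y - Y') \<le> 0" using that by simp_all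
      then show ?thesis by simp
    qed
    from this[OF 1 2 3] show ?thesis .
  qed
  finally show ?thesis by (simp add: d_def s_def)
qed

text \<open>
  For \<open>r = 1\<close> this is the function \<open>x\<^sup>m h x\<close>. For \<open>p = B\<close> and \<open>b = cnj B / A\<close> it is the image of the dilated
  function \<open>g (r \<cdot>)\<close> under the operator that maps \<open>g\<close> to \<open>x\<^sup>m h x\<close>. The power has to
  be split off because it is not evaluated at the dilated point.
\<close>
definition weighted_dilation ::
  "nat \<Rightarrow> complex \<Rightarrow> complex \<Rightarrow> (complex \<Rightarrow> complex) \<Rightarrow> real \<Rightarrow> complex \<Rightarrow> complex" where
  "weighted_dilation m p b h r x =
     (of_real r * x) ^ m * exp (- (of_real (1 - r) * (x - p) * b)) * h (p + of_real r * (x - p))"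

lemma weighted_dilation_holomorphic:
  assumes "h holomorphic_on UNIV"
  shows "weighted_dilation m p b h r holomorphic_on UNIV"
  unfolding weighted_dilation_def by (intro holomorphic_intros entire_compose[OF assms])

lemma weighted_dilation_locally_bounded:
  assumes h: "h holomorphic_on UNIV"
  shows "\<exists>C. \<forall>r z. 0 \<le> r \<longrightarrow> r \<le> 1 \<longrightarrow> cmod z \<le> \<rho> \<longrightarrow> cmod (weighted_dilation m p b h r z) \<le> C"
proof -
  have "continuous_on UNIV (\<lambda>q. weighted_dilation m p b h (fst q) (snd q))"
    unfolding weighted_dilation_def
    by (intro continuous_intros continuous_on_compose2[OF holomorphic_on_imp_continuous_on[OF h]]) auto
  then have "compact ((\<lambda>q. weighted_dilation m p b h (fst q) (snd q)) ` ({0..1} \<times> cball 0 \<rho>))"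
    by (intro compact_continuous_image compact_Times compact_Icc compact_cball) (auto intro: continuous_on_subset)
  then obtain C where C: "\<forall>y \<in> (\<lambda>q. weighted_dilation m p b h (fst q) (snd q)) ` ({0..1} \<times> cball 0 \<rho>). cmod y \<le> C"
    by (meson bounded_iff compact_imp_bounded)
  show ?thesis
  proof (intro exI[of _ C] allI impI)
    fix r :: real and z :: complex
    assume "0 \<le> r" "r \<le> 1" "cmod z \<le> \<rho>"
    then have "(r, z) \<in> {0..1} \<times> cball 0 \<rho>" by simp
    with C have "cmod (weighted_dilation m p b h (fst (r, z)) (snd (r, z))) \<le> C" by (meson image_eqI)
    then show "cmod (weighted_dilation m p b h r z) \<le> C" by simp
  qed
qed

text \<open>
  Near the origin, where \<open>|r x| \<le> 2 |p + r (x - p)|\<close> may fail, compactness gives the bound; elsewhere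
  the power can be moved to the dilated point, and \<open>weighted_dilation_weight\<close> together with an affine
  substitution bounds the integral by a multiple of the norm of \<open>x\<^sup>m h x\<close>.
\<close>
lemma weighted_dilation_fock:
  assumes f: "(\<lambda>x. x ^ m * h x) \<in> fock" and h: "h holomorphic_on UNIV"
  obtains M where "\<And>r. 1/2 \<le> r \<Longrightarrow> r \<le> 1 \<Longrightarrow>
    weighted_dilation m p b h r \<in> fock \<and> (LINT z|gauss. (cmod (weighted_dilation m p b h r z))\<^sup>2) \<le> M"
proof -
  let ?F = "weighted_dilation m p b h"
  define f where "f = (\<lambda>x. x ^ m * h x)"
  have ff: "f \<in> fock" using f by (simp add: f_def)
  obtain C where C: "\<And>r z. 0 \<le> r \<Longrightarrow> r \<le> 1 \<Longrightarrow> cmod z \<le> 2 * cmod p \<Longrightarrow> cmod (?F r z) \<le> C"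
    using weighted_dilation_locally_bounded[OF h, of "2 * cmod p" m p b] by blast
  define E where "E = exp ((cmod p + cmod b)\<^sup>2)"
  define w where "w = (\<lambda>x. exp (- (cmod x)\<^sup>2) / pi)"
  define I where "I = (LINT z|lborel. w z * (cmod (f z))\<^sup>2)"
  have exp_minus_split: "exp (a - c) = exp a * exp (- c)" for a c :: real
    by (simp add: exp_diff exp_minus field_simps)
  have wpos: "0 \<le> w x" for x by (simp add: w_def)
  have fI: "has_bochner_integral lborel (\<lambda>z. w z * (cmod (f z))\<^sup>2) I"
    using fock_integrable_square[OF ff] fock_measurable[OF ff]
    by (simp add: has_bochner_integral_iff I_def w_def integrable_gauss_iff)
  have I0: "0 \<le> I" unfolding I_def by (intro integral_nonneg_AE) (auto simp: wpos)
  have wI: "has_bochner_integral lborel w 1"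
    unfolding w_def using has_bochner_integral_divide_zero[OF has_bochner_integral_gaussian, of pi] by simp
  have "?F r \<in> fock \<and> (LINT z|gauss. (cmod (?F r z))\<^sup>2) \<le> C\<^sup>2 + 4 ^ m * E * (4 * I)" if r: "1/2 \<le> r" "r \<le> 1" for r
  proof -
    define T where "T = (\<lambda>x. p + of_real r * (x - p))"
    have T: "T x = of_real (1 - r) * p + r *\<^sub>R x" for x
      by (simp add: T_def scaleR_conv_of_real algebra_simps)
    have "has_bochner_integral lborel (\<lambda>x. w (T x) * (cmod (f (T x)))\<^sup>2) (I /\<^sub>R \<bar>r\<bar> ^ DIM(complex))"
      unfolding T using r by (intro has_bochner_integral_lborel_affine[OF fI]) auto
    then have TI: "has_bochner_integral lborel (\<lambda>x. w (T x) * (cmod (f (T x)))\<^sup>2) (I / r\<^sup>2)"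
      by (simp add: divide_inverse mult.commute)
    have upper: "has_bochner_integral lborel (\<lambda>x. C\<^sup>2 * w x + 4 ^ m * E * (w (T x) * (cmod (f (T x)))\<^sup>2)) (C\<^sup>2 * 1 + 4 ^ m * E * (I / r\<^sup>2))"
      by (intro has_bochner_integral_add has_bochner_integral_mult_right TI wI)
    have le: "w x * (cmod (?F r x))\<^sup>2 \<le> C\<^sup>2 * w x + 4 ^ m * E * (w (T x) * (cmod (f (T x)))\<^sup>2)" for x
    proof (cases "cmod x \<le> 2 * cmod p")
      case True
      have "(cmod (?F r x))\<^sup>2 \<le> C\<^sup>2" using C[OF _ r(2) True] r by (intro power_mono) auto
      then have "(cmod (?F r x))\<^sup>2 * w x \<le> C\<^sup>2 * w x" using wpos by (intro mult_right_mono)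
      then have "w x * (cmod (?F r x))\<^sup>2 \<le> C\<^sup>2 * w x" by (subst mult.commute)
      moreover have "0 \<le> 4 ^ m * E * (w (T x) * (cmod (f (T x)))\<^sup>2)" using wpos by (simp add: E_def)
      ultimately show ?thesis by linarith
    next
      case False
      have rx: "of_real r * x = T x - of_real (1 - r) * p" by (simp add: T_def algebra_simps)
      have "r * cmod x = cmod (T x - of_real (1 - r) * p)" using r unfolding rx[symmetric] by (simp add: norm_mult)
      also have "\<dots> \<le> cmod (T x) + (1 - r) * cmod p"
        using norm_triangle_ineq4[of "T x" "of_real (1 - r) * p"] r by (simp add: norm_mult del: of_real_diff)
      finally have 1: "r * cmod x \<le> cmod (T x) + (1 - r) * cmod p" .
      have "(1 - r) * cmod p \<le> r * cmod p" using r by (intro mult_right_mono) auto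
      moreover have "r * (2 * cmod p) \<le> r * cmod x" using False r by (intro mult_left_mono) auto
      ultimately have rx2: "r * cmod x \<le> 2 * cmod (T x)" using 1 by linarith
      have "cmod (?F r x) = (r * cmod x) ^ m * cmod (exp (- (of_real (1 - r) * (x - p) * b))) * cmod (h (T x))"
        using r by (simp add: weighted_dilation_def T_def norm_mult norm_power del: of_real_diff)
      also have "\<dots> \<le> (2 * cmod (T x)) ^ m * exp ((1 - r) * cmod (x - p) * cmod b) * cmod (h (T x))"
      proof (intro mult_right_mono mult_mono)
        show "(r * cmod x) ^ m \<le> (2 * cmod (T x)) ^ m"
          using rx2 r by (intro power_mono) auto
        show "cmod (exp (- (of_real (1 - r) * (x - p) * b))) \<le> exp ((1 - r) * cmod (x - p) * cmod b)"
          using norm_exp[of "- (of_real (1 - r) * (x - p) * b)"] r by (simp add: norm_mult del: of_real_diff)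
      qed auto
      also have "\<dots> = 2 ^ m * exp ((1 - r) * cmod (x - p) * cmod b) * cmod (f (T x))"
        by (simp add: f_def norm_mult norm_power power_mult_distrib)
      finally have "(cmod (?F r x))\<^sup>2 \<le> (2 ^ m * exp ((1 - r) * cmod (x - p) * cmod b) * cmod (f (T x)))\<^sup>2"
        by (intro power_mono) auto
      also have "\<dots> = 4 ^ m * exp (2 * ((1 - r) * cmod (x - p) * cmod b)) * (cmod (f (T x)))\<^sup>2"
      proof -
        have "((2::real) ^ m)\<^sup>2 = 4 ^ m" by (simp add: power2_eq_square flip: power_mult_distrib)
        moreover have "(exp y)\<^sup>2 = exp (2 * y)" for y :: real by (simp add: exp_double)
        ultimately show ?thesis unfolding power_mult_distrib by simp
      qed
      finally have "w x * (cmod (?F r x))\<^sup>2 \<le> w x * (4 ^ m * exp (2 * ((1 - r) * cmod (x - p) * cmod b)) * (cmod (f (T x)))\<^sup>2)"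
        using wpos by (intro mult_left_mono) auto
      also have "\<dots> = 4 ^ m * (exp (2 * ((1 - r) * cmod (x - p) * cmod b) - (cmod x)\<^sup>2) / pi) * (cmod (f (T x)))\<^sup>2"
        unfolding w_def exp_minus_split by (simp add: mult_ac)
      also have "\<dots> \<le> 4 ^ m * (exp ((cmod p + cmod b)\<^sup>2 - (cmod (T x))\<^sup>2) / pi) * (cmod (f (T x)))\<^sup>2"
        unfolding T_def using r by (intro mult_right_mono mult_left_mono divide_right_mono)
          (auto intro!: weighted_dilation_weight)
      also have "\<dots> = 4 ^ m * E * (w (T x) * (cmod (f (T x)))\<^sup>2)"
        unfolding w_def E_def exp_minus_split by (simp add: mult_ac)
      finally show ?thesis using wpos[of x] by (simp add: add_increasing)
    qed
    have hol: "?F r holomorphic_on UNIV" by (rule weighted_dilation_holomorphic[OF h])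
    note [measurable] = entire_borel_measurable[OF hol]
    have [measurable]: "w \<in> borel_measurable borel" unfolding w_def by measurable
    have int: "integrable lborel (\<lambda>x. w x * (cmod (?F r x))\<^sup>2)"
      by (rule Bochner_Integration.integrable_bound[OF integrable.intros[OF upper]])
         (auto simp: wpos intro!: order_trans[OF le abs_ge_self])
    have "?F r \<in> fock"
      using hol int by (simp add: fock_gauss integrable_gauss_iff w_def)
    moreover have "(LINT z|gauss. (cmod (?F r z))\<^sup>2) \<le> C\<^sup>2 + 4 ^ m * E * (4 * I)"
    proof -
      have "(LINT z|gauss. (cmod (?F r z))\<^sup>2) = (LINT x|lborel. w x * (cmod (?F r x))\<^sup>2)"
        by (simp add: integral_gauss w_def)
      also have "\<dots> \<le> (LINT x|lborel. C\<^sup>2 * w x + 4 ^ m * E * (w (T x) * (cmod (f (T x)))\<^sup>2))"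
        by (intro integral_mono int integrable.intros[OF upper] le)
      also have "\<dots> = C\<^sup>2 + 4 ^ m * E * (I / r\<^sup>2)"
        using upper by (simp add: has_bochner_integral_iff)
      also have "\<dots> \<le> C\<^sup>2 + 4 ^ m * E * (4 * I)"
      proof -
        have "(1/2)\<^sup>2 \<le> r\<^sup>2" using r by (intro power_mono) auto
        then have "1 / r\<^sup>2 \<le> 4" using r by (simp add: field_simps power2_eq_square)
        then have "I / r\<^sup>2 \<le> 4 * I" using I0 mult_right_mono[of "1 / r\<^sup>2" 4 I] by simp
        then show ?thesis by (intro add_left_mono mult_left_mono) (auto simp: E_def)
      qed
      finally show ?thesis .
    qed
    ultimately show ?thesis by blast
  qed
  then show ?thesis by (rule that)
qed

lemma weighted_dilation_tendsto:
  assumes f: "(\<lambda>x. x ^ m * h x) \<in> fock" and h: "h holomorphic_on UNIV" and g: "g \<in> fock"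
    and r: "\<And>n. 1/2 \<le> r n" "\<And>n. r n \<le> 1" "r \<longlonglongrightarrow> 1"
  shows "weighted_dilation m p b h (r n) \<in> fock" 
    and "(\<lambda>n. fock_inner (weighted_dilation m p b h (r n)) g) \<longlonglongrightarrow> fock_inner (\<lambda>x. x ^ m * h x) g"
proof -
  obtain M where M: "\<And>r. 1/2 \<le> r \<Longrightarrow> r \<le> 1 \<Longrightarrow>
    weighted_dilation m p b h r \<in> fock \<and> (LINT z|gauss. (cmod (weighted_dilation m p b h r z))\<^sup>2) \<le> M"
    using weighted_dilation_fock[OF f h] by blast
  show "weighted_dilation m p b h (r n) \<in> fock" using M r by blast
  show "(\<lambda>n. fock_inner (weighted_dilation m p b h (r n)) g) \<longlonglongrightarrow> fock_inner (\<lambda>x. x ^ m * h x) g"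
  proof (rule fock_inner_tendsto_weak[OF _ f g])
    show "weighted_dilation m p b h (r n) \<in> fock"
      "(LINT z|gauss. (cmod (weighted_dilation m p b h (r n) z))\<^sup>2) \<le> M" for n using M r by blast+
    show "\<exists>C. \<forall>n z. cmod z \<le> \<rho> \<longrightarrow> cmod (weighted_dilation m p b h (r n) z) \<le> C" for \<rho>
    proof -
      have "0 \<le> r n" for n using r(1)[of n] by linarith
      then show ?thesis using weighted_dilation_locally_bounded[OF h, of \<rho> m p b] r(2) by meson
    qed
    fix z
    have "isCont h y" for y
      using holomorphic_on_imp_continuous_on[OF h] by (simp add: continuous_on_eq_continuous_at)
    then have "(\<lambda>n. weighted_dilation m p b h (r n) z) \<longlonglongrightarrow>
       (of_real 1 * z) ^ m * exp (- (of_real (1 - 1) * (z - p) * b)) * h (p + of_real 1 * (z - p))"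
      unfolding weighted_dilation_def by (intro tendsto_intros r isCont_tendsto_compose[of _ h])
    then show "(\<lambda>n. weighted_dilation m p b h (r n) z) \<longlonglongrightarrow> z ^ m * h z" by simp
  qed
qed

lemma fock_dilation_tendsto:
  assumes f: "f \<in> fock" and g: "g \<in> fock"
    and r: "\<And>n. 1/2 \<le> r n" "\<And>n. r n \<le> 1" "r \<longlonglongrightarrow> 1"
  shows "(\<lambda>n. fock_inner (\<lambda>x. f (of_real (r n) * x)) g) \<longlonglongrightarrow> fock_inner f g"
  using weighted_dilation_tendsto(2)[of 0 f g r 0 0] assms
  by (simp add: weighted_dilation_def[abs_def] fock_holomorphic)

section \<open>Multiplication by a power, differentiation and contractions\<close>

text \<open>Off the unit disc \<open>h\<close> is dominated by \<open>x\<^sup>m h x\<close>, and on the disc it is bounded.\<close>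
lemma fock_div_power:
  assumes f: "(\<lambda>x. x ^ m * h x) \<in> fock" and h: "h holomorphic_on UNIV"
  shows "h \<in> fock"
  unfolding fock_gauss
proof
  note [measurable] = entire_borel_measurable[OF h]
  have "compact (h ` cball 0 1)"
    by (intro compact_continuous_image continuous_on_subset[OF holomorphic_on_imp_continuous_on[OF h]]) auto
  then obtain C where C: "\<forall>y\<in>h ` cball 0 1. cmod y \<le> C"
    by (meson bounded_iff compact_imp_bounded)
  have "integrable gauss (\<lambda>x. C\<^sup>2 + (cmod (x ^ m * h x))\<^sup>2)"
    using fock_integrable_square[OF f] by simp
  then show "integrable gauss (\<lambda>z. (cmod (h z))\<^sup>2)"
  proof (rule Bochner_Integration.integrable_bound)
    have "(cmod (h x))\<^sup>2 \<le> C\<^sup>2 + (cmod (x ^ m * h x))\<^sup>2" for x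
    proof (cases "cmod x \<le> 1")
      case True
      then have "cmod (h x) \<le> C" using C by simp
      then have "(cmod (h x))\<^sup>2 \<le> C\<^sup>2" by (intro power_mono) auto
      then show ?thesis by (simp add: add_increasing2)
    next
      case False
      then have "1 * cmod (h x) \<le> cmod x ^ m * cmod (h x)"
        by (intro mult_right_mono one_le_power) auto
      then have "(cmod (h x))\<^sup>2 \<le> (cmod (x ^ m * h x))\<^sup>2"
        by (intro power_mono) (auto simp: norm_mult norm_power)
      then show ?thesis by (simp add: add_increasing)
    qed
    then show "AE x in gauss. norm ((cmod (h x))\<^sup>2) \<le> norm (C\<^sup>2 + (cmod (x ^ m * h x))\<^sup>2)"
      by simp
  qed measurable
qed (fact h)

definition radius :: "nat \<Rightarrow> real" where
  "radius n = 1 - inverse (real n + 2)"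

lemma radius: "1/2 \<le> radius n" "radius n < 1" "radius \<longlonglongrightarrow> 1"
proof -
  have "inverse (real n + 2) \<le> inverse 2" by (intro le_imp_inverse_le) auto
  then show "1/2 \<le> radius n" by (simp add: radius_def)
  show "radius n < 1" by (simp add: radius_def)
  have "(\<lambda>n. inverse (real n + 2)) \<longlonglongrightarrow> 0"
  proof -
    have "(\<lambda>n. inverse (real n)) \<longlonglongrightarrow> 0" by (rule lim_inverse_n)
    from LIMSEQ_ignore_initial_segment[OF this, of 2] show ?thesis by (simp add: add.commute)
  qed
  then have "(\<lambda>n. 1 - inverse (real n + 2)) \<longlonglongrightarrow> 1 - 0" by (intro tendsto_intros)
  then show "radius \<longlonglongrightarrow> 1" by (simp add: radius_def[abs_def])
qed

text \<open>
  For the dilated function \<open>x\<^sup>m h x\<close> the representation of \<open>h\<close> by its reproducing kernel may be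
  inserted and the integrals exchanged, because the dilation makes the kernel grow only like
  \<open>e\<^bsup>r |x| |z|\<^esup>\<close>. Then \<open>r\<close> tends to 1 on both sides.
\<close>
lemma fock_mult_power_adjoint:
  assumes f: "(\<lambda>x. x ^ m * h x) \<in> fock" and h: "h holomorphic_on UNIV"
    and g: "g \<in> fock" and dg: "(deriv ^^ m) g \<in> fock"
  shows "fock_inner (\<lambda>x. x ^ m * h x) g = fock_inner h ((deriv ^^ m) g)"
proof -
  define k where "k = (deriv ^^ m) g"
  have hf: "h \<in> fock" by (rule fock_div_power[OF f h])
  have eq: "fock_inner (\<lambda>x. (of_real r * x) ^ m * h (of_real r * x)) g =
      of_real (r ^ m) * cnj (fock_inner (\<lambda>z. k (of_real r * z)) h)" if r: "0 \<le> r" "r < 1" for r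
  proof -
    define \<kappa> where "\<kappa> = (\<lambda>x z. (of_real r * x) ^ m * exp (of_real r * x * cnj z))"
    have "(of_real r * x) ^ m * h (of_real r * x) = fock_inner h (\<lambda>z. cnj (\<kappa> x z))" for x
    proof -
      have "(\<lambda>z. cnj (\<kappa> x z)) = (\<lambda>z. cnj ((of_real r * x) ^ m) * exp (z * cnj (of_real r * x)))"
        by (auto simp: \<kappa>_def exp_cnj mult_ac)
      then show ?thesis by (simp only: fock_inner_cmult_right fock_reproducing[OF hf] complex_cnj_cnj)
    qed
    then have "fock_inner (\<lambda>x. (of_real r * x) ^ m * h (of_real r * x)) g =
        fock_inner (\<lambda>x. fock_inner h (\<lambda>z. cnj (\<kappa> x z))) g" by simp
    also have "\<dots> = fock_inner h (\<lambda>z. fock_inner g (\<lambda>x. \<kappa> x z))"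
    proof (rule fock_inner_exchange[OF hf g _ _ r])
      show "continuous_on UNIV (\<lambda>p. \<kappa> (fst p) (snd p))"
        unfolding \<kappa>_def by (intro continuous_intros)
      fix x z
      have "cmod (\<kappa> x z) = r ^ m * cmod x ^ m * cmod (exp (of_real r * x * cnj z))"
        using r by (simp add: \<kappa>_def norm_mult norm_power power_mult_distrib)
      also have "\<dots> \<le> 1 * (fact m * exp (cmod x)) * exp (r * (cmod x * cmod z))"
        using r norm_exp[of "of_real r * x * cnj z"]
        by (intro mult_mono power_le_one power_le_fact_exp) (auto simp: norm_mult mult_ac)
      also have "\<dots> = fact m * exp (r * (cmod x * cmod z) + 1 * cmod x + 0)"
        by (simp add: exp_add)
      also have "\<dots> \<le> fact m * exp (r * (cmod x * cmod z) + 1 * cmod x + 1 * cmod z)"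
        by (intro mult_left_mono) auto
      finally show "cmod (\<kappa> x z) \<le> fact m * exp (r * (cmod x * cmod z) + 1 * cmod x + 1 * cmod z)" .
    qed
    also have "(\<lambda>z. fock_inner g (\<lambda>x. \<kappa> x z)) = (\<lambda>z. of_real (r ^ m) * k (of_real r * z))"
    proof
      fix z
      have "(\<lambda>x. \<kappa> x z) = (\<lambda>x. of_real (r ^ m) * (x ^ m * exp (x * cnj (of_real r * z))))"
        by (auto simp: \<kappa>_def power_mult_distrib mult_ac)
      then show "fock_inner g (\<lambda>x. \<kappa> x z) = of_real (r ^ m) * k (of_real r * z)"
        by (simp only: fock_inner_cmult_right fock_reproducing_deriv[OF g] k_def complex_cnj_complex_of_real)
    qed
    also have "fock_inner h (\<lambda>z. of_real (r ^ m) * k (of_real r * z)) = of_real (r ^ m) * fock_inner h (\<lambda>z. k (of_real r * z))"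
      by (simp only: fock_inner_cmult_right complex_cnj_complex_of_real)
    also have "fock_inner h (\<lambda>z. k (of_real r * z)) = cnj (fock_inner (\<lambda>z. k (of_real r * z)) h)"
      by (rule fock_inner_cnj)
    finally show ?thesis .
  qed
  have "(\<lambda>n. fock_inner (\<lambda>x. (of_real (radius n) * x) ^ m * h (of_real (radius n) * x)) g)
      \<longlonglongrightarrow> fock_inner (\<lambda>x. x ^ m * h x) g"
    using fock_dilation_tendsto[OF f g, of radius] radius less_imp_le[OF radius(2)] by simp
  note lim1 = this
  have lim2: "(\<lambda>n. of_real (radius n ^ m) * cnj (fock_inner (\<lambda>z. k (of_real (radius n) * z)) h))
      \<longlonglongrightarrow> of_real (1 ^ m) * cnj (fock_inner k h)"
    using fock_dilation_tendsto[OF dg hf, of radius] radius less_imp_le[OF radius(2)]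
    by (intro tendsto_intros radius) (auto simp: k_def)
  have eq': "(\<lambda>n. fock_inner (\<lambda>x. (of_real (radius n) * x) ^ m * h (of_real (radius n) * x)) g)
      = (\<lambda>n. of_real (radius n ^ m) * cnj (fock_inner (\<lambda>z. k (of_real (radius n) * z)) h))"
  proof
    fix n
    have "0 \<le> radius n" using radius(1)[of n] by linarith
    then show "fock_inner (\<lambda>x. (of_real (radius n) * x) ^ m * h (of_real (radius n) * x)) g
      = of_real (radius n ^ m) * cnj (fock_inner (\<lambda>z. k (of_real (radius n) * z)) h)"
      by (rule eq) (rule radius)
  qed
  have "fock_inner (\<lambda>x. x ^ m * h x) g = of_real (1 ^ m) * cnj (fock_inner k h)"
    by (rule LIMSEQ_unique[OF lim1[unfolded eq'] lim2])
  then show ?thesis using fock_inner_cnj[of h k] by (simp add: k_def)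
qed

text \<open>
  Up to factors \<open>e\<^bsup>C |w|\<^esup>\<close>, the Gaussian weight at \<open>w\<close> is smaller than that at \<open>x = A w + B\<close> by the factor
  \<open>e\<^bsup>-(1 - A\<^sup>2) |w|\<^sup>2\<^esup>\<close>, which absorbs these and the exponential.
\<close>
lemma fock_contraction:
  fixes A :: real
  assumes h: "h \<in> fock" and A: "A \<noteq> 0" "\<bar>A\<bar> < 1"
  shows "(\<lambda>w. exp (w * cnj B) * h (of_real A * w + B)) \<in> fock" (is "?k \<in> _")
  unfolding fock_gauss
proof
  show hol: "?k holomorphic_on UNIV"
    by (intro holomorphic_intros entire_compose[OF fock_holomorphic[OF h]])
  note [measurable] = entire_borel_measurable[OF hol] fock_measurable[OF h]
  define b where "b = cmod B"
  \<comment> \<open>The surplus of quadratic decay that a contraction leaves.\<close>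
  define q where "q = 1 - A\<^sup>2"
  have q: "q > 0" using A(2) by (simp add: q_def abs_square_less_1)
  define E where "E = exp (4 * b\<^sup>2 / q + b\<^sup>2)"
  have expo: "2 * (x * b) - x\<^sup>2 \<le> 4 * b\<^sup>2 / q + b\<^sup>2 - y\<^sup>2"
    if "0 \<le> x" "0 \<le> y" "y \<le> \<bar>A\<bar> * x + b" for x y :: real
  proof -
    have b: "0 \<le> b" by (simp add: b_def)
    have "y\<^sup>2 \<le> (\<bar>A\<bar> * x + b)\<^sup>2" using that by (intro power_mono) auto
    also have "\<dots> = A\<^sup>2 * x\<^sup>2 + 2 * (\<bar>A\<bar> * (x * b)) + b\<^sup>2" by (simp add: power2_eq_square algebra_simps)
    also have "\<dots> \<le> A\<^sup>2 * x\<^sup>2 + 2 * (1 * (x * b)) + b\<^sup>2"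
      using A that(1) b by (intro add_mono mult_left_mono mult_right_mono) auto
    finally have 1: "y\<^sup>2 \<le> A\<^sup>2 * x\<^sup>2 + 2 * (x * b) + b\<^sup>2" by simp
    have "0 \<le> (q * x - 2 * b)\<^sup>2 / q" using q by simp
    also have "\<dots> = q * x\<^sup>2 - 4 * (x * b) + 4 * b\<^sup>2 / q"
      using q by (simp add: field_simps power2_eq_square)
    also have "q * x\<^sup>2 = x\<^sup>2 - A\<^sup>2 * x\<^sup>2" by (simp add: q_def algebra_simps)
    finally show ?thesis using 1 by linarith
  qed
  have "has_bochner_integral lborel (\<lambda>z. exp (- (cmod z)\<^sup>2) / pi * (cmod (h z))\<^sup>2) (LINT z|gauss. (cmod (h z))\<^sup>2)"
    using fock_integrable_square[OF h]
    by (simp add: has_bochner_integral_iff integrable_gauss_iff integral_gauss)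
  from integrable.intros[OF has_bochner_integral_lborel_affine[OF this A(1), of B]]
  have "integrable lborel (\<lambda>w. E * (exp (- (cmod (B + A *\<^sub>R w))\<^sup>2) / pi * (cmod (h (B + A *\<^sub>R w)))\<^sup>2))"
    by (rule integrable_mult_right)
  then have "integrable lborel (\<lambda>w. exp (- (cmod w)\<^sup>2) / pi * (cmod (?k w))\<^sup>2)"
  proof (rule Bochner_Integration.integrable_bound)
    have "exp (- (cmod w)\<^sup>2) / pi * (cmod (?k w))\<^sup>2 \<le> E * (exp (- (cmod (B + A *\<^sub>R w))\<^sup>2) / pi * (cmod (h (B + A *\<^sub>R w)))\<^sup>2)" for w
    proof -
      have aff: "of_real A * w + B = B + A *\<^sub>R w" by (simp add: scaleR_conv_of_real)
      have "cmod (exp (w * cnj B)) \<le> exp (cmod w * b)"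
        using norm_exp[of "w * cnj B"] by (simp add: norm_mult b_def)
      then have "(cmod (exp (w * cnj B)))\<^sup>2 \<le> (exp (cmod w * b))\<^sup>2" by (intro power_mono) auto
      also have "\<dots> = exp (2 * (cmod w * b))" by (simp add: exp_double)
      finally have "exp (- (cmod w)\<^sup>2) * (cmod (exp (w * cnj B)))\<^sup>2 \<le> exp (- (cmod w)\<^sup>2) * exp (2 * (cmod w * b))"
        by (intro mult_left_mono) auto
      also have "\<dots> = exp (2 * (cmod w * b) - (cmod w)\<^sup>2)" by (simp add: exp_add[symmetric])
      also have "\<dots> \<le> exp (4 * b\<^sup>2 / q + b\<^sup>2 - (cmod (B + A *\<^sub>R w))\<^sup>2)"
      proof -
        have "cmod (B + A *\<^sub>R w) \<le> \<bar>A\<bar> * cmod w + b"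
          using norm_triangle_ineq[of B "A *\<^sub>R w"] by (simp add: b_def)
        then show ?thesis by (subst exp_le_cancel_iff) (intro expo; simp)
      qed
      also have "\<dots> = E * exp (- (cmod (B + A *\<^sub>R w))\<^sup>2)" by (simp add: E_def exp_add[symmetric])
      finally have "exp (- (cmod w)\<^sup>2) * (cmod (exp (w * cnj B)))\<^sup>2 * ((cmod (h (B + A *\<^sub>R w)))\<^sup>2 / pi)
         \<le> E * exp (- (cmod (B + A *\<^sub>R w))\<^sup>2) * ((cmod (h (B + A *\<^sub>R w)))\<^sup>2 / pi)"
        by (intro mult_right_mono) auto
      then show ?thesis unfolding aff by (simp add: norm_mult power_mult_distrib mult_ac)
    qed
    then show "AE w in lborel. norm (exp (- (cmod w)\<^sup>2) / pi * (cmod (?k w))\<^sup>2)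
      \<le> norm (E * (exp (- (cmod (B + A *\<^sub>R w))\<^sup>2) / pi * (cmod (h (B + A *\<^sub>R w)))\<^sup>2))"
      by (intro AE_I2) (simp add: E_def)
  qed measurable
  then show "integrable gauss (\<lambda>z. (cmod (?k z))\<^sup>2)"
    by (simp add: integrable_gauss_iff)
qed

section \<open>Kernel pairs in the adjoint and the functional equation\<close>

lemma higher_deriv_exp_linear: "(deriv ^^ m) (\<lambda>w. exp (w * a)) = (\<lambda>w. a ^ m * exp (w * a))" for a :: complex
proof (induction m)
  case (Suc m)
  have "((\<lambda>w. a ^ m * exp (w * a)) has_field_derivative a ^ Suc m * exp (w * a)) (at w)" for w
    by (auto intro!: derivative_eq_intros)
  then show ?case by (auto simp: Suc.IH DERIV_imp_deriv simp del: power_Suc)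
qed simp

text \<open>
  Membership of this pair in the adjoint is the defining equation at the point \<open>z\<close>, written with
  reproducing kernels.
\<close>
lemma kernel_pair_in_adjoint:
  "(\<lambda>w. cnj (F z) * (w ^ m * exp (w * cnj z)), \<lambda>w. exp (w * cnj (\<phi> z)))
     \<in> adjoint_graph (Smax_graph m (\<lambda>_. 1) \<phi> F)"
  unfolding adjoint_graph_def Smax_graph_def
proof (clarify, intro conjI ballI)
  show "(\<lambda>w. cnj (F z) * (w ^ m * exp (w * cnj z))) \<in> fock" by (rule fock_cmult[OF fock_power_exp])
  show "(\<lambda>w. exp (w * cnj (\<phi> z))) \<in> fock" by (rule fock_exp)
  fix p assume "p \<in> {(f, g). f \<in> fock \<and> g \<in> fock \<and> (\<forall>z. 1 * f (\<phi> z) = F z * (deriv ^^ m) g z)}"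
  then obtain f g where p: "p = (f, g)" and f: "f \<in> fock" and g: "g \<in> fock" and "f (\<phi> z) = F z * (deriv ^^ m) g z"
    by auto
  then show "case p of (f, g) \<Rightarrow> fock_inner g (\<lambda>w. cnj (F z) * (w ^ m * exp (w * cnj z))) = fock_inner f (\<lambda>w. exp (w * cnj (\<phi> z)))"
    by (simp add: p fock_inner_cmult_right fock_reproducing_deriv[OF g] fock_reproducing[OF f])
qed

lemma adjoint_subset_imp_kernel_identity:
  assumes "adjoint_graph (Smax_graph m (\<lambda>_. 1) \<phi> F) \<subseteq> Smax_graph m (\<lambda>_. 1) \<phi> F"
  shows "cnj (F z) * (\<phi> w ^ m * exp (\<phi> w * cnj z)) = F w * (cnj (\<phi> z) ^ m * exp (w * cnj (\<phi> z)))"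
proof -
  have "(\<lambda>w. cnj (F z) * (w ^ m * exp (w * cnj z)), \<lambda>w. exp (w * cnj (\<phi> z))) \<in> Smax_graph m (\<lambda>_. 1) \<phi> F"
    using assms kernel_pair_in_adjoint by blast
  then show ?thesis by (simp add: Smax_graph_def higher_deriv_exp_linear)
qed

lemma entire_mult_eq_0:
  assumes "f holomorphic_on UNIV" "g holomorphic_on UNIV" "f w \<noteq> 0" "\<And>z. f z * g z = 0"
  shows "g z = 0"
proof (rule analytic_continuation_open[of "{z. f z \<noteq> 0}" UNIV g "\<lambda>_. 0"])
  have "open (f -` (- {0}))"
    using holomorphic_on_imp_continuous_on[OF assms(1)] by (intro open_vimage) (auto simp: continuous_on_eq_continuous_at)
  then show "open {z. f z \<noteq> 0}" by (simp add: vimage_def Compl_eq)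
qed (use assms in auto)

text \<open>
  The identity at one fixed \<open>z\<close> writes \<open>F\<close> as \<open>\<phi>\<^sup>m q\<close> with \<open>q\<close> zero free. The powers of \<open>\<phi>\<close> then cancel, first
  in \<open>w\<close> and then in \<open>z\<close>, because \<open>\<phi>\<^sup>m\<close> does not vanish identically. What remains is an identity of
  exponentials for all \<open>w\<close> and \<open>z\<close>: at \<open>z = 0\<close> it determines \<open>q\<close>, and differentiating the exponent in \<open>w\<close>
  shows that \<open>\<phi>\<close> is affine with real slope.
\<close>
lemma kernel_identity_solution:
  assumes \<phi>: "\<phi> holomorphic_on UNIV" and F: "F holomorphic_on UNIV"
    and F0: "\<exists>z. F z \<noteq> 0" and nonconst: "m > 0 \<Longrightarrow> \<not> \<phi> constant_on UNIV"
    and id: "\<And>z w. cnj (F z) * (\<phi> w ^ m * exp (\<phi> w * cnj z)) = F w * (cnj (\<phi> z) ^ m * exp (w * cnj (\<phi> z)))"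
  obtains A C :: real and B :: complex where "C \<noteq> 0" "\<And>u. \<phi> u = of_real A * u + B"
    "\<And>u. of_real C * exp (u * cnj B) * F u = (of_real A * u + B) ^ m"
proof -
  have pm: "(\<lambda>w. \<phi> w ^ m) holomorphic_on UNIV" by (intro holomorphic_intros \<phi>)
  \<comment> \<open>For \<open>m = 0\<close> the power is the constant 1, whatever \<open>\<phi>\<close> is.\<close>
  obtain w1 where w1: "\<phi> w1 ^ m \<noteq> 0"
  proof (cases "m = 0")
    case False
    then have "\<not> \<phi> constant_on UNIV" using nonconst by simp
    then obtain w where "\<phi> w \<noteq> 0" unfolding constant_on_def by (metis UNIV_I)
    then show ?thesis by (intro that[of w]) simp
  qed (use that[of 0] in simp)
  obtain z0 where z0: "F z0 \<noteq> 0" "\<phi> z0 ^ m \<noteq> 0"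
    using entire_mult_eq_0[OF pm F w1] F0 by (metis mult_eq_0_iff)
  define q where "q = (\<lambda>w. cnj (F z0) / cnj (\<phi> z0 ^ m) * exp (\<phi> w * cnj z0 - w * cnj (\<phi> z0)))"
  have qF: "F w = \<phi> w ^ m * q w" for w
  proof -
    have "F w * cnj (\<phi> z0) ^ m * exp (w * cnj (\<phi> z0)) = \<phi> w ^ m * (cnj (F z0) * exp (\<phi> w * cnj z0))"
      using id[of z0 w] by (simp add: mult_ac)
    then show ?thesis using z0(2) by (simp add: q_def exp_diff field_simps)
  qed
  have qhol: "q holomorphic_on UNIV" unfolding q_def by (intro holomorphic_intros \<phi>)
  have q0: "q w \<noteq> 0" for w using z0 by (simp add: q_def)
  have id1: "cnj (q z) * exp (\<phi> w * cnj z) = q w * exp (w * cnj (\<phi> z))" if "\<phi> z ^ m \<noteq> 0" for w z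
  proof -
    have "cnj (q z) * exp (\<phi> w * cnj z) - q w * exp (w * cnj (\<phi> z)) = 0"
    proof (rule entire_mult_eq_0[where z = w and g = "\<lambda>w. cnj (q z) * exp (\<phi> w * cnj z) - q w * exp (w * cnj (\<phi> z))", OF pm _ w1])
      show "(\<lambda>w. cnj (q z) * exp (\<phi> w * cnj z) - q w * exp (w * cnj (\<phi> z))) holomorphic_on UNIV"
        by (intro holomorphic_intros \<phi> qhol)
      fix w
      have "cnj (\<phi> z ^ m) * (\<phi> w ^ m * (cnj (q z) * exp (\<phi> w * cnj z) - q w * exp (w * cnj (\<phi> z)))) = 0"
        using id[of z w] unfolding qF by (simp add: algebra_simps)
      then show "\<phi> w ^ m * (cnj (q z) * exp (\<phi> w * cnj z) - q w * exp (w * cnj (\<phi> z))) = 0"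
        using that by (simp only: mult_eq_0_iff complex_cnj_zero_iff) simp
    qed
    then show ?thesis by simp
  qed
  have id2: "cnj (q z) * exp (\<phi> w * cnj z) = q w * exp (w * cnj (\<phi> z))" for w z
  proof -
    have "q z * exp (cnj (\<phi> w) * z) - cnj (q w) * exp (cnj w * \<phi> z) = 0"
    proof (rule entire_mult_eq_0[where z = z and g = "\<lambda>z. q z * exp (cnj (\<phi> w) * z) - cnj (q w) * exp (cnj w * \<phi> z)", OF pm _ w1])
      show "(\<lambda>z. q z * exp (cnj (\<phi> w) * z) - cnj (q w) * exp (cnj w * \<phi> z)) holomorphic_on UNIV"
        by (intro holomorphic_intros \<phi> qhol)
      fix z
      show "\<phi> z ^ m * (q z * exp (cnj (\<phi> w) * z) - cnj (q w) * exp (cnj w * \<phi> z)) = 0"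
      proof (cases "\<phi> z ^ m = 0")
        case False
        have "cnj (cnj (q z) * exp (\<phi> w * cnj z)) = cnj (q w * exp (w * cnj (\<phi> z)))"
          by (simp only: id1[OF False])
        then show ?thesis by (simp add: exp_cnj)
      qed simp
    qed
    then have "cnj (q z * exp (cnj (\<phi> w) * z)) = cnj (cnj (q w) * exp (cnj w * \<phi> z))" by simp
    then show ?thesis by (simp add: exp_cnj)
  qed
  define B where "B = \<phi> 0"
  define c where "c = Re (q 0)"
  have c: "q 0 = of_real c"
  proof -
    have "cnj (q 0) = q 0" using id2[of 0 0] by simp
    then show ?thesis by (auto simp: c_def complex_eq_iff)
  qed
  have c0: "c \<noteq> 0" using q0[of 0] c by auto
  have qw: "q w = of_real c * exp (- (w * cnj B))" for w
    using id2[of 0 w] by (simp add: c B_def exp_minus field_simps)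
  have e1: "exp ((\<phi> w - B) * cnj z - w * cnj (\<phi> z - B)) = 1" for w z
  proof -
    have "of_real c * exp (- (cnj z * B)) * exp (\<phi> w * cnj z) = of_real c * exp (- (w * cnj B)) * exp (w * cnj (\<phi> z))"
      using id2[of z w] by (simp add: qw exp_cnj)
    then have "exp (- (cnj z * B) + \<phi> w * cnj z) = exp (- (w * cnj B) + w * cnj (\<phi> z))"
      using c0 unfolding exp_add by simp
    moreover have "(\<phi> w - B) * cnj z - w * cnj (\<phi> z - B)
       = (- (cnj z * B) + \<phi> w * cnj z) - (- (w * cnj B) + w * cnj (\<phi> z))"
      by (simp add: algebra_simps)
    ultimately show ?thesis by (simp only: exp_diff) simp
  qed
  have d: "deriv \<phi> w * cnj z = cnj (\<phi> z - B)" for w z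
  proof -
    have "(\<phi> has_field_derivative deriv \<phi> w) (at w)"
      using \<phi> by (simp add: holomorphic_derivI)
    then have "((\<lambda>w. exp ((\<phi> w - B) * cnj z - w * cnj (\<phi> z - B))) has_field_derivative
       exp ((\<phi> w - B) * cnj z - w * cnj (\<phi> z - B)) * (deriv \<phi> w * cnj z - cnj (\<phi> z - B))) (at w)"
      by (auto intro!: derivative_eq_intros)
    then have "((\<lambda>w. 1) has_field_derivative (deriv \<phi> w * cnj z - cnj (\<phi> z - B))) (at w)"
      unfolding e1 by simp
    then have "deriv \<phi> w * cnj z - cnj (\<phi> z - B) = 0" by (rule DERIV_unique) simp
    then show ?thesis by (simp only: right_minus_eq)
  qed
  define A where "A = Re (\<phi> 1 - B)"
  have dphi: "deriv \<phi> w = cnj (\<phi> 1 - B)" for w using d[of w 1] by simp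
  have lin: "\<phi> z = (\<phi> 1 - B) * z + B" for z
  proof -
    have "cnj (\<phi> z - B) = cnj (\<phi> 1 - B) * cnj z" using d[of 0 z] dphi[of 0] by simp
    then have "\<phi> z - B = (\<phi> 1 - B) * z" by (metis complex_cnj_cnj complex_cnj_mult)
    then show ?thesis by (simp add: algebra_simps)
  qed
  have "((\<lambda>z. (\<phi> 1 - B) * z + B) has_field_derivative (\<phi> 1 - B)) (at 0)"
    by (auto intro!: derivative_eq_intros)
  moreover have "(\<lambda>z. (\<phi> 1 - B) * z + B) = \<phi>" by (rule ext) (rule lin[symmetric])
  ultimately have "(\<phi> has_field_derivative (\<phi> 1 - B)) (at 0)" by (simp only:)
  then have "cnj (\<phi> 1 - B) = \<phi> 1 - B" using dphi[of 0] DERIV_imp_deriv by metis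
  then have A: "\<phi> 1 - B = of_real A" by (auto simp: A_def complex_eq_iff)
  show ?thesis
  proof (rule that[of "1 / c" A B])
    show "1 / c \<noteq> 0" using c0 by simp
    show \<phi>A: "\<phi> u = of_real A * u + B" for u using lin[of u] by (simp add: A)
    show "of_real (1 / c) * exp (u * cnj B) * F u = (of_real A * u + B) ^ m" for u
      unfolding qF qw \<phi>A using c0 by (simp add: exp_minus field_simps)
  qed
qed

section \<open>Symmetry for affine symbols\<close>

locale affine_symbol =
  fixes m :: nat and A c :: real and B :: complex
  assumes c0: "c \<noteq> 0" and A0: "A = 0 \<Longrightarrow> m = 0"
begin

definition symbol :: "complex \<Rightarrow> complex" where "symbol u = of_real A * u + B"

definition factor :: "complex \<Rightarrow> complex" where
  "factor u = of_real c * exp (- (u * cnj B)) * symbol u ^ m"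

abbreviation G :: mv_graph where "G \<equiv> Smax_graph m (\<lambda>_. 1) symbol factor"

lemma mem_G_iff: "(f, g) \<in> G \<longleftrightarrow> f \<in> fock \<and> g \<in> fock \<and> (\<forall>z. f (symbol z) = factor z * (deriv ^^ m) g z)"
  by (simp add: Smax_graph_def)

lemma kernel_pair_in_G:
  "(\<lambda>w. cnj (factor z) * (w ^ m * exp (w * cnj z)), \<lambda>w. exp (w * cnj (symbol z))) \<in> G"
  unfolding mem_G_iff
proof (intro conjI allI)
  show "(\<lambda>w. cnj (factor z) * (w ^ m * exp (w * cnj z))) \<in> fock" by (rule fock_cmult[OF fock_power_exp])
  show "(\<lambda>w. exp (w * cnj (symbol z))) \<in> fock" by (rule fock_exp)
  fix w
  have "exp (- (cnj z * B)) * exp (symbol w * cnj z) = exp (- (w * cnj B)) * exp (w * cnj (symbol z))"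
    unfolding exp_add[symmetric] by (simp add: symbol_def algebra_simps)
  then show "cnj (factor z) * (symbol w ^ m * exp (symbol w * cnj z)) = factor w * (deriv ^^ m) (\<lambda>w. exp (w * cnj (symbol z))) w"
    by (simp add: higher_deriv_exp_linear factor_def exp_cnj mult_ac) 
qed

text \<open>
  The kernel pairs belong to the relation, and by the reproducing property the condition on \<open>(u, v)\<close>
  that comes from the kernel pair at \<open>z\<close> is the defining equation at \<open>z\<close>.
\<close>
lemma adjoint_subset: "adjoint_graph G \<subseteq> G"
proof
  fix p assume p: "p \<in> adjoint_graph G"
  obtain u v where uv: "p = (u, v)" by (cases p)
  with p have u: "u \<in> fock" and v: "v \<in> fock"
    and adj: "\<And>f g. (f, g) \<in> G \<Longrightarrow> fock_inner g u = fock_inner f v"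
    by (auto simp: adjoint_graph_def)
  have "u (symbol z) = factor z * (deriv ^^ m) v z" for z
  proof -
    have "cnj (fock_inner u (\<lambda>w. exp (w * cnj (symbol z)))) = cnj (fock_inner v (\<lambda>w. cnj (factor z) * (w ^ m * exp (w * cnj z))))"
      using adj[OF kernel_pair_in_G[of z]] by (simp only: fock_inner_cnj[of u] fock_inner_cnj[of v] complex_cnj_cnj)
    then have "cnj (u (symbol z)) = cnj (factor z * (deriv ^^ m) v z)"
      by (simp add: fock_reproducing[OF u] fock_inner_cmult_right fock_reproducing_deriv[OF v])
    then show ?thesis by (simp only: complex_cnj_cancel_iff)
  qed
  then show "p \<in> G" using u v by (simp add: uv mem_G_iff)
qed

text \<open>
  This is \<open>T D\<^sup>m g\<close> in the factorisation \<open>f = x\<^sup>m T D\<^sup>m g\<close> of the relation; the second factor is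
  obtained by solving \<open>x = A u + B\<close> for \<open>u\<close>, so that \<open>A \<noteq> 0\<close> is understood.
\<close>
definition cofactor :: "(complex \<Rightarrow> complex) \<Rightarrow> complex \<Rightarrow> complex" where
  "cofactor g x = of_real c * exp (- ((x - B) / of_real A * cnj B)) * (deriv ^^ m) g ((x - B) / of_real A)"

lemma cofactor:
  assumes fg: "(f, g) \<in> G" and A: "A \<noteq> 0"
  shows "cofactor g holomorphic_on UNIV" "f = (\<lambda>x. x ^ m * cofactor g x)"
    "(deriv ^^ m) g w = of_real (inverse c) * (exp (w * cnj B) * cofactor g (symbol w))"
proof -
  from fg have f: "f \<in> fock" and g: "g \<in> fock" and eq: "\<And>z. f (symbol z) = factor z * (deriv ^^ m) g z"
    by (auto simp: mem_G_iff)
  have "(deriv ^^ m) g holomorphic_on UNIV" by (intro holomorphic_higher_deriv fock_holomorphic g open_UNIV)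
  then have "(\<lambda>x. (deriv ^^ m) g ((x - B) / of_real A)) holomorphic_on UNIV"
    by (rule entire_compose) (use A in \<open>intro holomorphic_intros; simp\<close>)
  moreover have "(\<lambda>x. of_real c * exp (- ((x - B) / of_real A * cnj B))) holomorphic_on UNIV"
    using A by (intro holomorphic_intros) auto
  ultimately show "cofactor g holomorphic_on UNIV"
    unfolding cofactor_def[abs_def] by (rule holomorphic_on_mult[rotated])
  show "f = (\<lambda>x. x ^ m * cofactor g x)"
  proof
    fix x
    have "symbol ((x - B) / of_real A) = x" using A by (simp add: symbol_def)
    then show "f x = x ^ m * cofactor g x"
      using eq[of "(x - B) / of_real A"] by (simp add: factor_def cofactor_def mult_ac)
  qed
  have "(symbol w - B) / of_real A = w" using A by (simp add: symbol_def)
  then have q: "cofactor g (symbol w) = of_real c * exp (- (w * cnj B)) * (deriv ^^ m) g w"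
    by (simp only: cofactor_def)
  show "(deriv ^^ m) g w = of_real (inverse c) * (exp (w * cnj B) * cofactor g (symbol w))"
    unfolding q using c0 by (simp add: exp_minus field_simps)
qed

text \<open>For a constant symbol \<open>g\<close> is determined by the single value \<open>f B\<close>.\<close>
lemma symmetric_rank_one:
  assumes A: "A = 0" and fg1: "(f1, g1) \<in> G" and fg2: "(f2, g2) \<in> G"
  shows "fock_inner g1 f2 = fock_inner f1 g2"
proof -
  have g: "g = (\<lambda>z. (f B / of_real c) * exp (z * cnj B))" if "(f, g) \<in> G" for f g
  proof
    fix z
    have fB: "f B = of_real c * exp (- (z * cnj B)) * g z"
    proof -
      have "f (symbol z) = factor z * (deriv ^^ m) g z" using that by (simp add: mem_G_iff)
      then show ?thesis unfolding factor_def symbol_def using A A0[OF A] by simp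
    qed
    show "g z = (f B / of_real c) * exp (z * cnj B)"
      unfolding fB using c0 by (simp add: exp_minus field_simps)
  qed
  have f: "f1 \<in> fock" "f2 \<in> fock" using fg1 fg2 by (auto simp: mem_G_iff)
  have "fock_inner g1 f2 = cnj (fock_inner f2 g1)" by (rule fock_inner_cnj)
  also have "fock_inner f2 g1 = cnj (f1 B / of_real c) * f2 B"
    by (subst g[OF fg1]) (simp only: fock_inner_cmult_right fock_reproducing[OF f(2)])
  also have "cnj (cnj (f1 B / of_real c) * f2 B) = cnj (f2 B / of_real c) * f1 B" by simp
  also have "\<dots> = fock_inner f1 g2"
    by (subst g[OF fg2]) (simp only: fock_inner_cmult_right fock_reproducing[OF f(1)])
  finally show ?thesis .
qed

text \<open>
  Moving the power across turns both sides into inner products of the cofactor of one pair with the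
  derivative of the other. The derivative is the image of the cofactor under an integral operator
  whose kernel \<open>\<kappa>\<close> grows like \<open>e\<^bsup>|A| |w| |z|\<^esup>\<close> and is hermitian.
\<close>
lemma symmetric_contraction:
  assumes A: "A \<noteq> 0" "\<bar>A\<bar> < 1" and fg1: "(f1, g1) \<in> G" and fg2: "(f2, g2) \<in> G"
  shows "fock_inner g1 f2 = fock_inner f1 g2"
proof -
  have h: "cofactor g \<in> fock" and k: "(deriv ^^ m) g \<in> fock" if fg: "(f, g) \<in> G" for f g
  proof -
    have "f \<in> fock" using fg by (simp add: mem_G_iff)
    then have "(\<lambda>x. x ^ m * cofactor g x) \<in> fock" by (subst (asm) cofactor(2)[OF fg A(1)])
    then show h: "cofactor g \<in> fock" by (rule fock_div_power) (rule cofactor(1)[OF fg A(1)])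
    have "(deriv ^^ m) g = (\<lambda>w. of_real (inverse c) * (exp (w * cnj B) * cofactor g (of_real A * w + B)))"
      by (rule ext) (simp only: cofactor(3)[OF fg A(1)] symbol_def)
    then show "(deriv ^^ m) g \<in> fock"
      by (simp only: fock_cmult[OF fock_contraction[OF h A]])
  qed
  have move: "fock_inner f1 g2 = fock_inner (cofactor g1) ((deriv ^^ m) g2)"
    if fg1: "(f1, g1) \<in> G" and fg2: "(f2, g2) \<in> G" for f1 g1 f2 g2
  proof -
    have "f1 \<in> fock" "g2 \<in> fock" using that by (auto simp: mem_G_iff)
    then show ?thesis
      unfolding cofactor(2)[OF fg1 A(1)]
      by (intro fock_mult_power_adjoint cofactor(1)[OF fg1 A(1)] k[OF fg2]) auto
  qed
  define \<kappa> where "\<kappa> = (\<lambda>w z. of_real (inverse c) * exp (w * cnj B) * exp (symbol w * cnj z))"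
  have "(deriv ^^ m) g1 = (\<lambda>w. fock_inner (cofactor g1) (\<lambda>z. cnj (\<kappa> w z)))"
  proof
    fix w
    have "(\<lambda>z. cnj (\<kappa> w z)) = (\<lambda>z. cnj (of_real (inverse c) * exp (w * cnj B)) * exp (z * cnj (symbol w)))"
      by (auto simp: \<kappa>_def exp_cnj mult_ac)
    then show "(deriv ^^ m) g1 w = fock_inner (cofactor g1) (\<lambda>z. cnj (\<kappa> w z))"
      by (simp only: fock_inner_cmult_right fock_reproducing[OF h[OF fg1]] complex_cnj_cnj cofactor(3)[OF fg1 A(1)] mult.assoc)
  qed
  then have "fock_inner ((deriv ^^ m) g1) (cofactor g2) = fock_inner (\<lambda>w. fock_inner (cofactor g1) (\<lambda>z. cnj (\<kappa> w z))) (cofactor g2)"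
    by simp
  also have "\<dots> = fock_inner (cofactor g1) (\<lambda>z. fock_inner (cofactor g2) (\<lambda>w. \<kappa> w z))"
  proof (rule fock_inner_exchange[OF h[OF fg1] h[OF fg2] _ _ _ A(2)])
    show "continuous_on UNIV (\<lambda>p. \<kappa> (fst p) (snd p))"
      unfolding \<kappa>_def symbol_def by (intro continuous_intros)
    fix w z
    have "\<kappa> w z = of_real (inverse c) * exp (w * cnj B + symbol w * cnj z)"
      by (simp add: \<kappa>_def exp_add)
    also have "cmod \<dots> \<le> \<bar>inverse c\<bar> * exp (cmod (w * cnj B + symbol w * cnj z))"
      unfolding norm_mult norm_of_real by (intro mult_left_mono norm_exp) auto
    also have "\<dots> \<le> \<bar>inverse c\<bar> * exp (\<bar>A\<bar> * (cmod w * cmod z) + cmod B * cmod w + cmod B * cmod z)"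
    proof (intro mult_left_mono)
      have "cmod (w * cnj B + symbol w * cnj z) = cmod (w * cnj B + (of_real A * w * cnj z + B * cnj z))"
        by (simp add: symbol_def algebra_simps)
      also have "\<dots> \<le> cmod (w * cnj B) + (cmod (of_real A * w * cnj z) + cmod (B * cnj z))"
        by (intro norm_triangle_le add_left_mono norm_triangle_ineq)
      finally have "cmod (w * cnj B + symbol w * cnj z) \<le> \<bar>A\<bar> * (cmod w * cmod z) + cmod B * cmod w + cmod B * cmod z"
        by (simp add: norm_mult mult_ac)
      then show "exp (cmod (w * cnj B + symbol w * cnj z)) \<le> exp (\<bar>A\<bar> * (cmod w * cmod z) + cmod B * cmod w + cmod B * cmod z)"
        by simp
    qed auto
    finally show "cmod (\<kappa> w z) \<le> \<bar>inverse c\<bar> * exp (\<bar>A\<bar> * (cmod w * cmod z) + cmod B * cmod w + cmod B * cmod z)" .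
  qed simp
  also have "(\<lambda>z. fock_inner (cofactor g2) (\<lambda>w. \<kappa> w z)) = (deriv ^^ m) g2"
  proof
    fix z
    have "\<kappa> w z = cnj (of_real (inverse c) * exp (z * cnj B)) * exp (w * cnj (symbol z))" for w
    proof -
      have "exp (w * cnj B) * exp (symbol w * cnj z) = exp (cnj z * B) * exp (w * cnj (symbol z))"
        unfolding exp_add[symmetric] by (simp add: symbol_def algebra_simps)
      then show ?thesis by (simp add: \<kappa>_def exp_cnj mult.assoc)
    qed
    then have "(\<lambda>w. \<kappa> w z) = (\<lambda>w. cnj (of_real (inverse c) * exp (z * cnj B)) * exp (w * cnj (symbol z)))" by blast
    then show "fock_inner (cofactor g2) (\<lambda>w. \<kappa> w z) = (deriv ^^ m) g2 z"
      by (simp only: fock_inner_cmult_right fock_reproducing[OF h[OF fg2]] complex_cnj_cnj cofactor(3)[OF fg2 A(1)] mult.assoc)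
  qed
  finally have "fock_inner ((deriv ^^ m) g1) (cofactor g2) = fock_inner (cofactor g1) ((deriv ^^ m) g2)" .
  then show ?thesis
    using move[OF fg1 fg2] move[OF fg2 fg1] fock_inner_cnj[of g1 f2] fock_inner_cnj[of "(deriv ^^ m) g1" "cofactor g2"] by simp
qed

text \<open>
  For \<open>r < 1\<close> the dilated function \<open>g1 (r \<cdot>)\<close> is a superposition of the kernels \<open>e\<^bsup>r x cnj z\<^esup>\<close>, and its image
  \<open>D r\<close> is the corresponding superposition of the functions \<open>\<kappa> (\<cdot>) z\<close>. As \<open>|A| \<ge> 1\<close>, their growth is
  still that of \<open>e\<^bsup>r |x| |z|\<^esup>\<close>. Integrating \<open>g2\<close> against \<open>\<kappa> (\<cdot>) z\<close> reproduces \<open>f2 (r z)\<close>. The limit \<open>r \<rightarrow> 1\<close> is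
  the weak convergence of dilations.
\<close>
lemma symmetric_expansion:
  assumes A: "1 \<le> \<bar>A\<bar>" and fg1: "(f1, g1) \<in> G" and fg2: "(f2, g2) \<in> G"
  shows "fock_inner g1 f2 = fock_inner f1 g2"
proof -
  have A0: "A \<noteq> 0" using A by auto
  have f: "f1 \<in> fock" "f2 \<in> fock" and g: "g1 \<in> fock" "g2 \<in> fock" using fg1 fg2 by (auto simp: mem_G_iff)
  define h where "h = cofactor g1"
  note h = cofactor(1)[OF fg1 A0, folded h_def] and f1 = cofactor(2)[OF fg1 A0, folded h_def]
  define D where "D = weighted_dilation m B (cnj B / of_real A) h"
  have eq: "fock_inner (D r) g2 = cnj (fock_inner (\<lambda>z. f2 (of_real r * z)) g1)" if r: "0 \<le> r" "r < 1" for r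
  proof -
    define y where "y = (\<lambda>x. of_real r * (x - B) / of_real A)"
    define \<kappa> where "\<kappa> = (\<lambda>x z. of_real c * (of_real r * x) ^ m * exp (- ((x - B) / of_real A * cnj B)) * (cnj z ^ m * exp (cnj z * y x)))"
    have "D r = (\<lambda>x. fock_inner g1 (\<lambda>z. cnj (\<kappa> x z)))"
    proof
      fix x
      have "(\<lambda>z. cnj (\<kappa> x z)) = (\<lambda>z. cnj (of_real c * (of_real r * x) ^ m * exp (- ((x - B) / of_real A * cnj B))) * (z ^ m * exp (z * cnj (y x))))"
        by (auto simp: \<kappa>_def exp_cnj mult_ac)
      then have "fock_inner g1 (\<lambda>z. cnj (\<kappa> x z)) = of_real c * (of_real r * x) ^ m * exp (- ((x - B) / of_real A * cnj B)) * (deriv ^^ m) g1 (y x)"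
        by (simp only: fock_inner_cmult_right fock_reproducing_deriv[OF g(1)] complex_cnj_cnj)
      also have "\<dots> = D r x"
      proof -
        have "exp (- ((x - B) / of_real A * cnj B)) = exp (- (of_real (1 - r) * (x - B) * (cnj B / of_real A))) * exp (- (y x * cnj B))"
        proof -
          define t where "t = (x - B) / of_real A"
          have "of_real (1 - r) * (x - B) * (cnj B / of_real A) = of_real (1 - r) * (t * cnj B)" "y x = of_real r * t"
            by (simp_all add: t_def y_def)
          moreover have "- (t * cnj B) = - (of_real (1 - r) * (t * cnj B)) + - (of_real r * t * cnj B)"
            by (simp add: algebra_simps)
          ultimately show ?thesis by (simp only: exp_add[symmetric] t_def[symmetric])
        qed
        moreover have "(B + of_real r * (x - B) - B) / of_real A = y x" by (simp add: y_def)
        ultimately show ?thesis by (simp add: D_def weighted_dilation_def h_def cofactor_def mult_ac del: of_real_diff)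
      qed
      finally show "D r x = fock_inner g1 (\<lambda>z. cnj (\<kappa> x z))" ..
    qed
    then have "fock_inner (D r) g2 = fock_inner (\<lambda>x. fock_inner g1 (\<lambda>z. cnj (\<kappa> x z))) g2" by simp
    also have "\<dots> = fock_inner g1 (\<lambda>z. fock_inner g2 (\<lambda>x. \<kappa> x z))"
    proof (rule fock_inner_exchange[OF g _ _ r])
      show "continuous_on UNIV (\<lambda>p. \<kappa> (fst p) (snd p))"
        unfolding \<kappa>_def y_def using A0 by (intro continuous_intros) auto
      fix x z
      let ?M = "\<bar>c\<bar> * (fact m * fact m) * exp (cmod B * cmod B)"
      let ?e = "r * (cmod x * cmod z) + (1 + cmod B) * cmod x + (1 + cmod B) * cmod z"
      have yb: "cmod (y x) \<le> r * (cmod x + cmod B)" and xb: "cmod ((x - B) / of_real A) \<le> cmod x + cmod B"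
      proof -
        have "cmod ((x - B) / of_real A) = cmod (x - B) / \<bar>A\<bar>" by (simp add: norm_divide)
        also have "\<dots> \<le> cmod (x - B) / 1" using A by (intro divide_left_mono) auto
        also have "\<dots> \<le> cmod x + cmod B" using norm_triangle_ineq4[of x B] by simp
        finally show xb: "cmod ((x - B) / of_real A) \<le> cmod x + cmod B" .
        have "y x = of_real r * ((x - B) / of_real A)" by (simp add: y_def)
        then show "cmod (y x) \<le> r * (cmod x + cmod B)"
          using mult_left_mono[OF xb r(1)] r by (simp only: norm_mult norm_of_real abs_of_nonneg)
      qed
      have 1: "cmod (exp (- ((x - B) / of_real A * cnj B))) \<le> exp ((cmod x + cmod B) * cmod B)"
      proof -
        have "cmod (- ((x - B) / of_real A * cnj B)) \<le> (cmod x + cmod B) * cmod B"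
          unfolding norm_minus_cancel norm_mult complex_mod_cnj by (intro mult_right_mono xb) auto
        then show ?thesis by (intro order_trans[OF norm_exp]) simp
      qed
      have 2: "cmod (exp (cnj z * y x)) \<le> exp (r * (cmod x * cmod z) + cmod B * cmod z)"
      proof -
        have "cmod (cnj z * y x) \<le> cmod z * (r * (cmod x + cmod B))"
          unfolding norm_mult complex_mod_cnj by (intro mult_left_mono yb) auto
        also have "\<dots> = r * (cmod x * cmod z) + r * (cmod B * cmod z)" by (simp add: algebra_simps)
        also have "\<dots> \<le> r * (cmod x * cmod z) + 1 * (cmod B * cmod z)"
          using r by (intro add_left_mono mult_right_mono) auto
        finally show ?thesis by (intro order_trans[OF norm_exp]) simp
      qed
      have 3: "cmod ((of_real r * x) ^ m) \<le> fact m * exp (cmod x)"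
      proof -
        have "cmod ((of_real r * x) ^ m) = (r * cmod x) ^ m" using r by (simp add: norm_power norm_mult)
        also have "\<dots> \<le> cmod x ^ m" using r by (intro power_mono mult_left_le_one_le) auto
        also have "\<dots> \<le> fact m * exp (cmod x)" by (rule power_le_fact_exp) simp
        finally show ?thesis .
      qed
      have 4: "cmod (cnj z ^ m) \<le> fact m * exp (cmod z)"
        using power_le_fact_exp[of "cmod z" m] by (simp add: norm_power)
      have "cmod (\<kappa> x z) = \<bar>c\<bar> * cmod ((of_real r * x) ^ m) * cmod (exp (- ((x - B) / of_real A * cnj B))) * (cmod (cnj z ^ m) * cmod (exp (cnj z * y x)))"
        unfolding \<kappa>_def norm_mult norm_of_real ..
      also have "\<dots> \<le> \<bar>c\<bar> * (fact m * exp (cmod x)) * exp ((cmod x + cmod B) * cmod B) * ((fact m * exp (cmod z)) * exp (r * (cmod x * cmod z) + cmod B * cmod z))"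
        by (intro mult_mono 1 2 3 4 order_refl) auto
      also have "\<dots> = \<bar>c\<bar> * (fact m * fact m) * (exp (cmod x) * exp ((cmod x + cmod B) * cmod B) * (exp (cmod z) * exp (r * (cmod x * cmod z) + cmod B * cmod z)))"
        by (simp only: mult_ac)
      also have "exp (cmod x) * exp ((cmod x + cmod B) * cmod B) * (exp (cmod z) * exp (r * (cmod x * cmod z) + cmod B * cmod z))
         = exp (cmod B * cmod B) * exp ?e"
        unfolding exp_add[symmetric] by (simp add: algebra_simps)
      finally show "cmod (\<kappa> x z) \<le> ?M * exp ?e" by (simp only: mult.assoc)
    qed
    also have "(\<lambda>z. fock_inner g2 (\<lambda>x. \<kappa> x z)) = (\<lambda>z. f2 (of_real r * z))"
    proof
      fix z
      define a where "a = (of_real r * z - B) / of_real A"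
      define b where "b = of_real c * (of_real r * z) ^ m * exp (- (a * cnj B))"
      have "\<kappa> x z = cnj b * (x ^ m * exp (x * cnj a))" for x
      proof -
        have "exp (- ((x - B) / of_real A * cnj B)) * exp (cnj z * y x) = exp (- (cnj a * B)) * exp (x * cnj a)"
        proof -
          have a: "cnj a = (of_real r * cnj z - cnj B) / of_real A" by (simp add: a_def)
          have "- ((x - B) / of_real A * cnj B) + cnj z * y x = (x - B) * cnj a"
            unfolding a y_def using A0 by (simp add: field_simps)
          also have "\<dots> = - (cnj a * B) + x * cnj a" by (simp add: algebra_simps)
          finally show ?thesis by (simp only: exp_add[symmetric])
        qed
        moreover have "\<kappa> x z = of_real c * (of_real r ^ m * x ^ m * cnj z ^ m) * (exp (- ((x - B) / of_real A * cnj B)) * exp (cnj z * y x))"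
          by (simp add: \<kappa>_def power_mult_distrib mult_ac)
        ultimately show ?thesis by (simp add: b_def exp_cnj power_mult_distrib mult_ac)
      qed
      then have "(\<lambda>x. \<kappa> x z) = (\<lambda>x. cnj b * (x ^ m * exp (x * cnj a)))" by blast
      then have "fock_inner g2 (\<lambda>x. \<kappa> x z) = b * (deriv ^^ m) g2 a"
        by (simp only: fock_inner_cmult_right fock_reproducing_deriv[OF g(2)] complex_cnj_cnj)
      also have "\<dots> = f2 (of_real r * z)"
        using cofactor(2)[OF fg2 A0] by (simp add: cofactor_def a_def b_def mult_ac)
      finally show "fock_inner g2 (\<lambda>x. \<kappa> x z) = f2 (of_real r * z)" .
    qed
    also have "fock_inner g1 (\<lambda>z. f2 (of_real r * z)) = cnj (fock_inner (\<lambda>z. f2 (of_real r * z)) g1)"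
      by (rule fock_inner_cnj)
    finally show ?thesis .
  qed
  have lim1: "(\<lambda>n. fock_inner (D (radius n)) g2) \<longlonglongrightarrow> fock_inner f1 g2"
    unfolding D_def f1
    by (rule weighted_dilation_tendsto(2)) (use f(1) f1 h g radius less_imp_le[OF radius(2)] in auto)
  have lim2: "(\<lambda>n. cnj (fock_inner (\<lambda>z. f2 (of_real (radius n) * z)) g1)) \<longlonglongrightarrow> cnj (fock_inner f2 g1)"
    by (intro tendsto_intros fock_dilation_tendsto f g radius less_imp_le[OF radius(2)])
  have "fock_inner (D (radius n)) g2 = cnj (fock_inner (\<lambda>z. f2 (of_real (radius n) * z)) g1)" for n
  proof -
    have "0 \<le> radius n" using radius(1)[of n] by linarith
    then show ?thesis by (rule eq) (rule radius)
  qed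
  then have "fock_inner f1 g2 = cnj (fock_inner f2 g1)"
    using LIMSEQ_unique[OF lim1] lim2 by simp
  then show ?thesis using fock_inner_cnj[of g1 f2] by simp
qed

lemma hermitian: "hermitian_graph G"
  unfolding hermitian_graph_def
proof
  show "G \<subseteq> adjoint_graph G"
  proof
    fix p assume p: "p \<in> G"
    obtain f2 g2 where p2: "p = (f2, g2)" by (cases p)
    have "fock_inner g1 f2 = fock_inner f1 g2" if "(f1, g1) \<in> G" for f1 g1
    proof -
      consider "A = 0" | "A \<noteq> 0" "\<bar>A\<bar> < 1" | "1 \<le> \<bar>A\<bar>" by linarith
      then show ?thesis
        using symmetric_rank_one symmetric_contraction symmetric_expansion that p unfolding p2 by cases blast+
    qed
    then show "p \<in> adjoint_graph G" using p by (auto simp: p2 adjoint_graph_def mem_G_iff)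
  qed
qed (rule adjoint_subset)

end

section \<open>The characterisation\<close>

lemma Smax_graph_quotient:
  assumes "\<And>z. \<psi> z \<noteq> 0"
  shows "Smax_graph m \<psi> \<phi> \<theta> = Smax_graph m (\<lambda>_. 1) \<phi> (\<lambda>z. \<theta> z / \<psi> z)"
proof -
  have "\<psi> z * a = \<theta> z * b \<longleftrightarrow> 1 * a = \<theta> z / \<psi> z * b" for z a b
    using assms[of z] by (simp add: field_simps)
  then show ?thesis by (simp add: Smax_graph_def)
qed

text \<open>
  The identity holds off the exceptional set of the equivalence and off the zeros of \<open>\<psi>1\<close>; both are
  removed by continuity and by the identity theorem.
\<close>
lemma equivalent_triples_product:
  assumes eq: "equivalent_triples (\<psi>, \<phi>, \<theta>) (\<psi>1, \<phi>, \<theta>1)" and \<psi>: "\<And>z. \<psi> z \<noteq> 0"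
    and p: "p holomorphic_on UNIV" and e: "e holomorphic_on UNIV"
    and rel: "\<And>u. e u * \<theta>1 u = \<psi>1 u * p u"
  shows "e u * (\<theta> u / \<psi> u) = p u"
proof -
  have hol: "\<psi> holomorphic_on UNIV" "\<theta> holomorphic_on UNIV" "\<psi>1 holomorphic_on UNIV"
    and ev: "\<forall>\<^sub>\<approx>z\<in>UNIV. \<theta> z / \<psi> z = \<theta>1 z / \<psi>1 z" and "\<exists>z. \<psi>1 z \<noteq> 0"
    using eq by (auto simp: equivalent_triples_def)
  then obtain w where w: "\<psi>1 w \<noteq> 0" by blast
  define d where "d = (\<lambda>u. e u * (\<theta> u / \<psi> u) - p u)"
  have dhol: "d holomorphic_on UNIV" unfolding d_def using \<psi> by (intro holomorphic_intros hol p e) auto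
  have "\<psi>1 z * d z = 0" for z
  proof (rule tendsto_unique[of "at z"])
    have "(\<lambda>u. \<psi>1 u * d u) holomorphic_on UNIV" by (intro holomorphic_intros hol dhol)
    then have "isCont (\<lambda>u. \<psi>1 u * d u) z"
      using holomorphic_on_imp_continuous_on continuous_on_eq_continuous_at[OF open_UNIV] by blast
    then show "((\<lambda>u. \<psi>1 u * d u) \<longlongrightarrow> \<psi>1 z * d z) (at z)" by (simp add: isCont_def)
    have "\<forall>\<^sub>F u in at z. \<theta> u / \<psi> u = \<theta>1 u / \<psi>1 u"
      using ev by (simp add: eventually_cosparse_open_eq)
    then have "\<forall>\<^sub>F u in at z. \<psi>1 u * d u = 0"
    proof eventually_elim
      case (elim u)
      then show ?case using rel[of u] unfolding d_def elim by (cases "\<psi>1 u = 0") (auto simp: field_simps)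
    qed
    then show "((\<lambda>u. \<psi>1 u * d u) \<longlongrightarrow> 0) (at z)" by (rule tendsto_eventually)
  qed simp
  from entire_mult_eq_0[OF hol(3) dhol w this, of u] show ?thesis by (simp add: d_def)
qed

theorem theorem6p3:
  fixes m :: nat and \<psi> \<phi> \<theta> :: "complex \<Rightarrow> complex"
  assumes "\<psi> holomorphic_on UNIV" and "\<phi> holomorphic_on UNIV" and "\<theta> holomorphic_on UNIV"
    and "\<exists>z. \<theta> z \<noteq> 0"
    and "\<And>z. \<psi> z \<noteq> 0"
    and nonconst: "m > 0 \<Longrightarrow> \<not> \<phi> constant_on UNIV"
  shows "(hermitian_graph (Smax_graph m \<psi> \<phi> \<theta>) \<longleftrightarrow>
            adjoint_graph (Smax_graph m \<psi> \<phi> \<theta>) \<subseteq> Smax_graph m \<psi> \<phi> \<theta>)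
       \<and> (adjoint_graph (Smax_graph m \<psi> \<phi> \<theta>) \<subseteq> Smax_graph m \<psi> \<phi> \<theta> \<longleftrightarrow>
            (\<exists>\<psi>1 \<theta>1. \<exists>A C :: real. \<exists>B :: complex.
               equivalent_triples (\<psi>, \<phi>, \<theta>) (\<psi>1, \<phi>, \<theta>1) \<and> C \<noteq> 0 \<and>
               (\<forall>u. \<phi> u = complex_of_real A * u + B) \<and>
               (\<forall>u. complex_of_real C * exp (u * cnj B) * \<theta>1 u =
                      \<psi>1 u * (complex_of_real A * u + B) ^ m)))"
proof -
  let ?G = "Smax_graph m \<psi> \<phi> \<theta>"
  define F where "F = (\<lambda>z. \<theta> z / \<psi> z)"
  have G: "?G = Smax_graph m (\<lambda>_. 1) \<phi> F"
    unfolding F_def using assms(5) by (rule Smax_graph_quotient)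
  have F: "F holomorphic_on UNIV" unfolding F_def using assms by (intro holomorphic_intros) auto
  have F0: "\<exists>z. F z \<noteq> 0" using assms(4,5) by (auto simp: F_def)
  have 12: "adjoint_graph ?G \<subseteq> ?G" if "hermitian_graph ?G"
    using that by (simp add: hermitian_graph_def)
  have 23: "\<exists>\<psi>1 \<theta>1. \<exists>A C :: real. \<exists>B :: complex.
               equivalent_triples (\<psi>, \<phi>, \<theta>) (\<psi>1, \<phi>, \<theta>1) \<and> C \<noteq> 0 \<and>
               (\<forall>u. \<phi> u = complex_of_real A * u + B) \<and>
               (\<forall>u. complex_of_real C * exp (u * cnj B) * \<theta>1 u =
                      \<psi>1 u * (complex_of_real A * u + B) ^ m)"
    if sub: "adjoint_graph ?G \<subseteq> ?G"
  proof (rule kernel_identity_solution[OF assms(2) F F0 nonconst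
      adjoint_subset_imp_kernel_identity[OF sub[unfolded G]]])
    fix A C :: real and B :: complex
    assume C: "C \<noteq> 0" and \<phi>: "\<And>u. \<phi> u = of_real A * u + B"
      and FC: "\<And>u. of_real C * exp (u * cnj B) * F u = (of_real A * u + B) ^ m"
    have "of_real C * exp (u * cnj B) * \<theta> u = \<psi> u * (of_real A * u + B) ^ m" for u
      using FC[of u] assms(5)[of u] by (simp add: F_def field_simps)
    moreover have "equivalent_triples (\<psi>, \<phi>, \<theta>) (\<psi>, \<phi>, \<theta>)"
      using assms by (auto simp: equivalent_triples_def)
    ultimately show ?thesis using C \<phi> by blast
  qed
  have 31: "hermitian_graph ?G"
    if "equivalent_triples (\<psi>, \<phi>, \<theta>) (\<psi>1, \<phi>, \<theta>1)" and C: "C \<noteq> 0"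
      and \<phi>: "\<And>u. \<phi> u = complex_of_real A * u + B"
      and rel: "\<And>u. complex_of_real C * exp (u * cnj B) * \<theta>1 u = \<psi>1 u * (complex_of_real A * u + B) ^ m"
    for \<psi>1 \<theta>1 B and A C :: real
  proof -
    have FC: "of_real C * exp (u * cnj B) * F u = (of_real A * u + B) ^ m" for u
      unfolding F_def
      by (rule equivalent_triples_product[OF that(1) assms(5) _ _ rel]) (intro holomorphic_intros)+
    interpret affine_symbol m A "1 / C" B
    proof
      show "1 / C \<noteq> 0" using C by simp
      show "m = 0" if "A = 0"
        using nonconst \<phi> that by (auto simp: constant_on_def)
    qed
    have "F = factor"
    proof
      fix u
      show "F u = factor u" using FC[of u] C by (simp add: factor_def symbol_def exp_minus field_simps)
    qed
    moreover have "\<phi> = symbol" by (auto simp: symbol_def \<phi>)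
    ultimately show ?thesis using hermitian G by simp
  qed
  show ?thesis using 12 23 31 by blast
qed

end
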